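(* Let $n$ be an integer with $2\le n\le 34$ or $n=37$. Then for every set $S$ of $n$ positions in the formal $n$-square there exists a VH-shuffle $\sigma$ such that $\sigma(S)$ is an H-graph (a transversal of the columns).
   Context: The formal $n$-square is the set of $n^2$ positions $(k,r)$ with $0\le k,r<n$; $k$ is the column number and $r$ the row number. An H-move independently rotates each row: it is a permutation of positions of the form $(k,r)\mapsto (k+a_r \bmod n,\ r)$ for some integers $a_0,\dots,a_{n-1}$. A V-move independently rotates each column: it is a permutation of the form $(k,r)\mapsto(k,\ r+b_k \bmod n)$ for some integers $b_0,\dots,b_{n-1}$ (zero rotations allowed). A VH-shuffle is a V-move followed by an H-move. An H-graph is a set of $n$ positions of the form $\{(k,x_k): 0\le k<n\}$ with $0\le x_k<n$, i.e. a set containing exactly one position of each column. *)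

theory Defs
  imports Main "HOL-Combinatorics.Permutations"
begin

text \<open>A position is a pair (column, row). Coordinates are integers, so that \<open>mod\<close> reduces
  rotations by arbitrary (possibly negative) amounts into the range from 0 to n - 1.\<close>

type_synonym position = "int \<times> int"

definition square :: "nat \<Rightarrow> position set" where
  "square n = {(k, r). 0 \<le> k \<and> k < int n \<and> 0 \<le> r \<and> r < int n}"

text \<open>Moves are permutations of the square in the sense of \<open>permutes\<close>, which also fixes them to
  be the identity on pairs outside the square. The existence lemmas below show that every choice
  of rotation amounts is realised by a move.\<close>

definition H_move :: "nat \<Rightarrow> (position \<Rightarrow> position) \<Rightarrow> bool" where
  "H_move n h \<longleftrightarrow> h permutes square n \<and>
     (\<exists>a :: int \<Rightarrow> int. \<forall>(k, r) \<in> square n. h (k, r) = ((k + a r) mod int n, r))"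

definition V_move :: "nat \<Rightarrow> (position \<Rightarrow> position) \<Rightarrow> bool" where
  "V_move n v \<longleftrightarrow> v permutes square n \<and>
     (\<exists>b :: int \<Rightarrow> int. \<forall>(k, r) \<in> square n. v (k, r) = (k, (r + b k) mod int n))"

definition VH_shuffle :: "nat \<Rightarrow> (position \<Rightarrow> position) \<Rightarrow> bool" where
  "VH_shuffle n \<sigma> \<longleftrightarrow> (\<exists>v h. V_move n v \<and> H_move n h \<and> \<sigma> = h \<circ> v)"

definition H_graph :: "nat \<Rightarrow> position set \<Rightarrow> bool" where
  "H_graph n G \<longleftrightarrow>
     (\<exists>x :: int \<Rightarrow> int. (\<forall>k \<in> {0..<int n}. x k \<in> {0..<int n}) \<and> G = {(k, x k) | k. k \<in> {0..<int n}})"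

lemma finite_square: "finite (square n)"
proof (rule finite_subset)
  show "square n \<subseteq> {0..<int n} \<times> {0..<int n}" by (auto simp: square_def)
qed simp

lemma rotation_inj:
  fixes k k' c :: int
  assumes "(k + c) mod int n = (k' + c) mod int n" "0 \<le> k" "k < int n" "0 \<le> k'" "k' < int n"
  shows "k = k'"
proof -
  have "((k + c) - c) mod int n = ((k' + c) - c) mod int n"
    using assms(1) by (metis mod_diff_left_eq)
  then show ?thesis using assms(2-5) by simp
qed

lemma H_move_exists:
  "\<exists>h. H_move n h \<and> (\<forall>(k, r) \<in> square n. h (k, r) = ((k + a r) mod int n, r))"
proof -
  define h where "h = (\<lambda>(k, r). if (k, r) \<in> square n then ((k + a r) mod int n, r) else (k, r))"
  have "inj_on h (square n)"
    by (auto simp: inj_on_def h_def square_def dest: rotation_inj)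
  moreover have "h ` square n \<subseteq> square n"
    by (auto simp: h_def square_def)
  ultimately have "bij_betw h (square n) (square n)"
    using finite_square by (simp add: bij_betw_def endo_inj_surj)
  then have "h permutes square n"
    by (rule bij_imp_permutes) (auto simp: h_def split: prod.splits)
  then show ?thesis by (auto simp: H_move_def h_def intro!: exI[of _ h])
qed

lemma V_move_exists:
  "\<exists>v. V_move n v \<and> (\<forall>(k, r) \<in> square n. v (k, r) = (k, (r + b k) mod int n))"
proof -
  define v where "v = (\<lambda>(k, r). if (k, r) \<in> square n then (k, (r + b k) mod int n) else (k, r))"
  have "inj_on v (square n)"
    by (auto simp: inj_on_def v_def square_def dest: rotation_inj)
  moreover have "v ` square n \<subseteq> square n"
    by (auto simp: v_def square_def)
  ultimately have "bij_betw v (square n) (square n)"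
    using finite_square by (simp add: bij_betw_def endo_inj_surj)
  then have "v permutes square n"
    by (rule bij_imp_permutes) (auto simp: v_def split: prod.splits)
  then show ?thesis by (auto simp: V_move_def v_def intro!: exI[of _ v])
qed

end

(*
  After the V-move, row r carries a set A_r of columns; an H-move turns the result into an
  H-graph iff translates of the A_r partition Z/n. Placing the rows by decreasing size, a
  row of size s has a free translate as soon as s times the number of columns occupied so
  far is below n; so it suffices that the defect t, the sum of |A_r| - 1 over the nonempty
  rows, is small (about n/4 + 1).

  The V-move is built column by column. If d rows are occupied, some rotation of a column
  with c positions meets at most floor(c d / n) of them, by averaging. The columns may be
  taken in any order, and for each partition of n into column sizes some rotation of the
  sorted order makes the rounding gains large enough. For 27, 30, 31 and 32, the remaining
  size patterns miss the bound on t by one; there a weighted average controls which rows are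
  met, so that the row sizes are not among the few that the greedy argument cannot place.
  When nearly all rows have size 2, the last of them is placed by first putting two
  pairs so that two occupied columns differ exactly by the difference of the last pair.
*)

theory Submission
  imports Defs "HOL-Library.Code_Binary_Nat" "HOL-Library.Disjoint_Sets"
begin

section \<open>Packing translates\<close>

definition Z :: "nat \<Rightarrow> int set" where
  "Z n = {0..<int n}"

definition shift :: "nat \<Rightarrow> int \<Rightarrow> int set \<Rightarrow> int set" where
  "shift n a A = (\<lambda>x. (x + a) mod int n) ` A"

lemma finite_Z [simp]: "finite (Z n)"
  and card_Z [simp]: "card (Z n) = n"
  by (simp_all add: Z_def)

lemma mod_in_Z [simp]: "n > 0 \<Longrightarrow> x mod int n \<in> Z n"
  by (simp add: Z_def)

lemma mod_Z [simp]: "x \<in> Z n \<Longrightarrow> x mod int n = x"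
  by (simp add: Z_def)

lemma shift_subset: "n > 0 \<Longrightarrow> shift n a A \<subseteq> Z n"
  by (auto simp: shift_def)

lemma inj_on_shift: "inj_on (\<lambda>x. (x + a) mod int n) (Z n)"
  by (auto simp: inj_on_def Z_def dest: rotation_inj)

lemma card_shift: "A \<subseteq> Z n \<Longrightarrow> card (shift n a A) = card A"
  unfolding shift_def by (intro card_image inj_on_subset[OF inj_on_shift])

text \<open>Averaging over all \<open>n\<close> rotations: each point of \<open>A\<close> visits
  every residue once, so the weights of the translates add up to
  \<open>card A * sum w (Z n)\<close>, and some translate is at most the mean.\<close>

lemma shift_light:
  fixes w :: "int \<Rightarrow> nat"
  assumes "n > 0" "A \<subseteq> Z n"
  obtains a where "sum w (shift n a A) \<le> card A * sum w (Z n) div n"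
proof -
  have fin: "finite A" using assms(2) finite_subset finite_Z by blast
  have bij: "(\<Sum>a\<in>Z n. w ((y + a) mod int n)) = sum w (Z n)" for y
  proof -
    have "(\<lambda>x. (x + y) mod int n) ` Z n = Z n"
      using assms(1) by (intro endo_inj_surj inj_on_shift) auto
    then have "sum w (Z n) = (\<Sum>x\<in>Z n. w ((x + y) mod int n))"
      by (metis (no_types, lifting) inj_on_shift sum.reindex_cong)
    then show ?thesis by (simp add: add.commute)
  qed
  have "(\<Sum>a\<in>Z n. sum w (shift n a A)) = (\<Sum>a\<in>Z n. \<Sum>y\<in>A. w ((y + a) mod int n))"
    unfolding shift_def
    by (intro sum.cong refl sum.reindex_cong[OF inj_on_subset[OF inj_on_shift assms(2)]]) auto
  also have "\<dots> = card A * sum w (Z n)"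
    by (subst sum.swap) (simp add: bij)
  finally have eq: "(\<Sum>a\<in>Z n. sum w (shift n a A)) = card A * sum w (Z n)" .
  have "\<exists>a\<in>Z n. sum w (shift n a A) * n \<le> card A * sum w (Z n)"
  proof (rule ccontr)
    assume "\<not> ?thesis"
    then have *: "card A * sum w (Z n) < sum w (shift n a A) * n" if "a \<in> Z n" for a
      using that by (auto simp: not_le)
    have "(\<Sum>a\<in>Z n. card A * sum w (Z n)) < (\<Sum>a\<in>Z n. sum w (shift n a A) * n)"
      using assms(1) * by (intro sum_strict_mono) (auto simp: Z_def)
    then show False by (simp add: eq flip: sum_distrib_right)
  qed
  then show ?thesis
    using that assms(1) by (auto simp: less_eq_div_iff_mult_less_eq)
qed

text \<open>For \<open>A\<close> and \<open>B\<close> inside \<open>Z n\<close> these are exactly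
  the rotations of \<open>A\<close> that meet \<open>B\<close>.\<close>

definition diffs :: "nat \<Rightarrow> int set \<Rightarrow> int set \<Rightarrow> int set" where
  "diffs n B A = (\<lambda>(x, y). (x - y) mod int n) ` (B \<times> A)"

lemma card_diffs_le:
  assumes "finite A" "finite B"
  shows "card (diffs n B A) \<le> card A * card B"
  using card_image_le[of "B \<times> A" "\<lambda>(x, y). (x - y) mod int n"] assms
  by (simp add: diffs_def card_cartesian_product mult.commute)

lemma shift_avoids:
  assumes "A \<subseteq> Z n" "B \<subseteq> Z n" "card (diffs n B A) < n"
  obtains a where "shift n a A \<inter> B = {}"
proof -
  have "finite (diffs n B A)"
    unfolding diffs_def using assms(1,2) by (meson finite_SigmaI finite_Z finite_imageI finite_subset)
  then have "\<not> Z n \<subseteq> diffs n B A"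
    using assms(3) by (metis card_Z card_mono leD)
  then obtain a where a: "a \<in> Z n" "a \<notin> diffs n B A" by blast
  have "shift n a A \<inter> B = {}"
  proof (rule ccontr)
    assume "\<not> ?thesis"
    then obtain y where y: "y \<in> A" "(y + a) mod int n \<in> B" by (auto simp: shift_def)
    have "((y + a) mod int n - y) mod int n = a" using a by (simp add: mod_diff_left_eq)
    then have "a \<in> diffs n B A" unfolding diffs_def using y by force
    with a show False by simp
  qed
  then show ?thesis by (rule that)
qed

text \<open>Rows are placed by decreasing size: the induction sets a smallest row aside, packs the
  others, and places it last. Rows of equal size are counted against each other, so ties may be
  broken in any order. \<open>B\<close> holds columns occupied in advance.\<close>

lemma pack_greedy:
  assumes "n > 0" "finite I" "\<And>r. r \<in> I \<Longrightarrow> A r \<subseteq> Z n" "B \<subseteq> Z n"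
    and "\<And>r. r \<in> I \<Longrightarrow>
      card (A r) * (card B + (\<Sum>r'\<in>{r' \<in> I - {r}. card (A r) \<le> card (A r')}. card (A r'))) < n"
  shows "\<exists>a. disjoint_family_on (\<lambda>r. shift n (a r) (A r)) I \<and> (\<forall>r\<in>I. shift n (a r) (A r) \<inter> B = {})"
  using assms(2,3,5)
proof (induction "card I" arbitrary: I)
  case 0
  then show ?case by (auto simp: disjoint_family_on_def)
next
  case (Suc m)
  have fin: "finite I" by fact
  have "I \<noteq> {}" using Suc.hyps by auto
  then have "Min ((\<lambda>r. card (A r)) ` I) \<in> (\<lambda>r. card (A r)) ` I"
    using fin by (intro Min_in) auto
  then obtain r where r: "r \<in> I" "card (A r) = Min ((\<lambda>r. card (A r)) ` I)" by auto
  have min: "card (A r) \<le> card (A r')" if "r' \<in> I" for r'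
    using that fin r(2) by simp
  define J where "J = I - {r}"
  have I: "I = insert r J" "r \<notin> J" using r by (auto simp: J_def)
  have "\<exists>a. disjoint_family_on (\<lambda>r. shift n (a r) (A r)) J \<and> (\<forall>r\<in>J. shift n (a r) (A r) \<inter> B = {})"
  proof (rule Suc.hyps(1))
    show "m = card J" using Suc.hyps(2) I fin by auto
    fix r' assume r': "r' \<in> J"
    have "(\<Sum>x\<in>{x \<in> J - {r'}. card (A r') \<le> card (A x)}. card (A x))
      \<le> (\<Sum>x\<in>{x \<in> I - {r'}. card (A r') \<le> card (A x)}. card (A x))"
      using fin by (intro sum_mono2) (auto simp: J_def)
    then show "card (A r') * (card B + (\<Sum>x\<in>{x \<in> J - {r'}. card (A r') \<le> card (A x)}. card (A x))) < n"
      using Suc.prems(3)[of r'] r' I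
      by (meson add_left_mono insertI2 le_less_trans mult_le_mono2)
  qed (use fin Suc.prems in \<open>auto simp: J_def\<close>)
  then obtain a where a: "disjoint_family_on (\<lambda>r. shift n (a r) (A r)) J"
    "\<And>r. r \<in> J \<Longrightarrow> shift n (a r) (A r) \<inter> B = {}" by blast
  define U where "U = B \<union> (\<Union>r\<in>J. shift n (a r) (A r))"
  have finJ: "finite J" using fin by (simp add: J_def)
  have U: "U \<subseteq> Z n" using assms(4) shift_subset[OF assms(1)] unfolding U_def by blast
  have "card U \<le> card B + (\<Sum>r\<in>J. card (A r))"
  proof -
    have "card (\<Union>r\<in>J. shift n (a r) (A r)) \<le> (\<Sum>r\<in>J. card (shift n (a r) (A r)))"
      by (rule card_UN_le[OF finJ])
    also have "\<dots> = (\<Sum>r\<in>J. card (A r))"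
      using Suc.prems(2) I by (intro sum.cong) (auto simp: card_shift)
    finally show ?thesis unfolding U_def by (meson add_left_mono card_Un_le le_trans)
  qed
  \<comment> \<open>As \<open>r\<close> is smallest, all other rows count as larger, so the
    hypothesis bounds the whole of \<open>U\<close>.\<close>
  moreover have "{r' \<in> I - {r}. card (A r) \<le> card (A r')} = J" using min by (auto simp: J_def)
  ultimately have "card (A r) * card U < n"
    using Suc.prems(3)[OF r(1)] by (metis (no_types, lifting) le_less_trans mult_le_mono2)
  moreover have "card (diffs n U (A r)) \<le> card (A r) * card U"
    using U Suc.prems(2)[OF r(1)] by (intro card_diffs_le) (meson finite_Z finite_subset)+
  ultimately obtain s where s: "shift n s (A r) \<inter> U = {}"
    using shift_avoids[OF Suc.prems(2)[OF r(1)] U] by (metis le_less_trans)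
  show ?case
  proof (intro exI[of _ "a(r := s)"] conjI)
    show "disjoint_family_on (\<lambda>x. shift n ((a(r := s)) x) (A x)) I"
      unfolding I(1) using I(2) a(1) s by (auto simp: disjoint_family_on_def U_def)
    show "\<forall>x\<in>I. shift n ((a(r := s)) x) (A x) \<inter> B = {}"
      using I a(2) s by (auto simp: U_def)
  qed
qed

text \<open>The translates of \<open>I\<close> stay fixed, and their union is the set
  \<open>B\<close> that the greedy packing of \<open>J\<close> avoids.\<close>

lemma pack_extend:
  assumes "n > 0" "finite I" "finite J" "I \<inter> J = {}" "\<And>r. r \<in> I \<union> J \<Longrightarrow> A r \<subseteq> Z n"
    and "disjoint_family_on (\<lambda>r. shift n (a r) (A r)) I"
    and "\<And>r. r \<in> J \<Longrightarrow> card (A r) *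
      ((\<Sum>r'\<in>I. card (A r')) + (\<Sum>r'\<in>{r' \<in> J - {r}. card (A r) \<le> card (A r')}. card (A r'))) < n"
  shows "\<exists>a'. (\<forall>r\<in>I. a' r = a r) \<and> disjoint_family_on (\<lambda>r. shift n (a' r) (A r)) (I \<union> J)"
proof -
  define U where "U = (\<Union>r\<in>I. shift n (a r) (A r))"
  have "card U \<le> (\<Sum>r\<in>I. card (shift n (a r) (A r)))"
    unfolding U_def by (rule card_UN_le[OF assms(2)])
  also have "\<dots> = (\<Sum>r\<in>I. card (A r))"
    using assms(5) by (intro sum.cong) (auto simp: card_shift)
  finally have U: "card U \<le> (\<Sum>r\<in>I. card (A r))" .
  have "\<exists>s. disjoint_family_on (\<lambda>r. shift n (s r) (A r)) J \<and> (\<forall>r\<in>J. shift n (s r) (A r) \<inter> U = {})"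
  proof (rule pack_greedy)
    show "U \<subseteq> Z n" using shift_subset[OF assms(1)] unfolding U_def by blast
    show "card (A r) * (card U + (\<Sum>r'\<in>{r' \<in> J - {r}. card (A r) \<le> card (A r')}. card (A r'))) < n"
      if "r \<in> J" for r
      using assms(7)[OF that] U by (meson add_right_mono le_less_trans mult_le_mono2)
  qed (use assms in auto)
  then obtain s where s: "disjoint_family_on (\<lambda>r. shift n (s r) (A r)) J"
    "\<And>r. r \<in> J \<Longrightarrow> shift n (s r) (A r) \<inter> U = {}" by blast
  show ?thesis
  proof (intro exI[of _ "\<lambda>r. if r \<in> J then s r else a r"] conjI)
    show "\<forall>r\<in>I. (if r \<in> J then s r else a r) = a r" using assms(4) by auto
    show "disjoint_family_on (\<lambda>r. shift n (if r \<in> J then s r else a r) (A r)) (I \<union> J)"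
      unfolding disjoint_family_on_def
    proof (intro ballI impI)
      fix p q assume "p \<in> I \<union> J" "q \<in> I \<union> J" "p \<noteq> q"
      then show "shift n (if p \<in> J then s p else a p) (A p) \<inter> shift n (if q \<in> J then s q else a q) (A q) = {}"
        using s assms(6) unfolding disjoint_family_on_def U_def
        by (cases "p \<in> J"; cases "q \<in> J") (simp; blast)+
    qed
  qed
qed

section \<open>Placing two pairs so that a third one loses a forbidden rotation\<close>

lemma card_diffs_coincide:
  assumes "finite A" "finite B" "x \<in> B" "x' \<in> B" "z \<in> A" "z' \<in> A" "z \<noteq> z'"
    and "int n dvd (x - x') - (z - z')"
  shows "card (diffs n B A) < card A * card B"
proof -
  let ?g = "\<lambda>(x, y). (x - y) mod int n"
  have "int n dvd (x - z) - (x' - z')" using assms(8) by (simp add: algebra_simps)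
  then have "?g (x, z) = ?g (x', z')" by (simp add: mod_eq_dvd_iff)
  have "diffs n B A \<subseteq> ?g ` (B \<times> A - {(x, z)})"
  proof
    fix u assume "u \<in> diffs n B A"
    then obtain p where p: "p \<in> B \<times> A" "u = ?g p" unfolding diffs_def by blast
    show "u \<in> ?g ` (B \<times> A - {(x, z)})"
    proof (cases "p = (x, z)")
      case True
      with p(2) \<open>?g (x, z) = ?g (x', z')\<close> have "u = ?g (x', z')" by simp
      with assms show ?thesis by blast
    qed (use p in blast)
  qed
  then have "card (diffs n B A) \<le> card (B \<times> A - {(x, z)})"
    using assms(1,2) by (intro surj_card_le) auto
  also have "\<dots> < card (B \<times> A)"
    using assms by (intro psubset_card_mono) auto
  finally show ?thesis by (simp add: card_cartesian_product mult.commute)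
qed

text \<open>\<open>y\<close> is sent to \<open>x + f\<close>, so \<open>y'\<close> lands on
  \<open>x + f - (y - y')\<close>; the four non-divisibilities say that neither point hits
  \<open>x\<close> or \<open>x'\<close>.\<close>

lemma place_pair:
  assumes "n > 0" "x \<in> Z n" "x' \<in> Z n" "\<not> int n dvd f" "\<not> int n dvd x + f - x'"
    and "\<not> int n dvd f - (y - y')" "\<not> int n dvd x + f - (y - y') - x'"
  obtains b where "shift n b {y, y'} \<inter> {x, x'} = {}" "(x + f) mod int n \<in> shift n b {y, y'}"
proof
  let ?b = "x + f - y"
  have eq: "shift n ?b {y, y'} = {(x + f) mod int n, (x + f - (y - y')) mod int n}"
    by (simp add: shift_def algebra_simps)
  have ne: "u mod int n \<noteq> v" if "v \<in> Z n" "\<not> int n dvd u - v" for u v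
    using that by (metis mod_Z mod_eq_dvd_iff)
  show "shift n ?b {y, y'} \<inter> {x, x'} = {}"
    using ne[OF assms(2), of "x + f"] ne[OF assms(3), of "x + f"]
      ne[OF assms(2), of "x + f - (y - y')"] ne[OF assms(3), of "x + f - (y - y')"] assms
    unfolding eq by (auto simp: algebra_simps)
  show "(x + f) mod int n \<in> shift n ?b {y, y'}" by (simp add: eq)
qed

text \<open>For odd \<open>n\<close> the factor 2 cancels; for even \<open>n\<close> both numbers
  are odd multiples of \<open>n / 2\<close>.\<close>

lemma half_turn_unique:
  assumes "int n dvd 2 * a" "int n dvd 2 * b" "\<not> int n dvd a" "\<not> int n dvd b"
  shows "int n dvd a - b"
proof -
  have "even (int n)"
    using assms(1,3) by (metis coprime_dvd_mult_right_iff coprime_right_2_iff_odd)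
  then obtain m where m: "int n = 2 * m" by blast
  obtain u v where "a = m * u" "b = m * v" using assms(1,2) m by (auto simp: dvd_def)
  moreover have "odd u" "odd v" using calculation assms(3,4) m by auto
  then have "even (u - v)" by simp
  then obtain k where "u - v = 2 * k" by blast
  ultimately have "a - b = int n * k" using m by (simp add: algebra_simps flip: right_diff_distrib)
  then show ?thesis by simp
qed

text \<open>Only the three placements tried in the last case are needed: if each of them makes the pairs
  overlap, then both the difference of \<open>A\<close> and that of \<open>R\<close> are the unique residue of order 2.\<close>

lemma pairs_coincide:
  assumes "n > 4" "A \<subseteq> Z n" "B \<subseteq> Z n" "z \<in> Z n" "z' \<in> Z n" "z \<noteq> z'" "card A = 2" "card B = 2"
  obtains b o1 o2 where "shift n b B \<inter> A = {}" "o1 \<in> A \<union> shift n b B" "o2 \<in> A \<union> shift n b B"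
    "int n dvd (o1 - o2) - (z - z')"
proof -
  have n: "n > 0" using assms(1) by simp
  obtain x x' where A: "A = {x, x'}" "x \<noteq> x'" using assms(7) by (auto simp: card_2_iff)
  obtain y y' where B: "B = {y, y'}" "y \<noteq> y'" using assms(8) by (auto simp: card_2_iff)
  have x: "x \<in> Z n" "x' \<in> Z n" using assms(2) A by auto
  define f where "f = z - z'"
  have f: "\<not> int n dvd f" using assms(4-6) unfolding f_def by (metis mod_Z mod_eq_dvd_iff)
  have al: "\<not> int n dvd x - x'" using x A(2) by (metis mod_Z mod_eq_dvd_iff)
  \<comment> \<open>There are at most four differences, and \<open>n > 4\<close>. Any disjoint
    placement will do if one of the pairs already has the difference \<open>f\<close>.\<close>
  have "card (diffs n A B) < n"
    using card_diffs_le[of B A n] A B assms by (simp add: card_2_iff)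
  then obtain b0 where b0: "shift n b0 B \<inter> A = {}"
    using shift_avoids[OF assms(3,2)] by blast
  have "\<exists>b o1 o2. shift n b B \<inter> A = {} \<and> o1 \<in> A \<union> shift n b B \<and> o2 \<in> A \<union> shift n b B
      \<and> int n dvd (o1 - o2) - f"
  proof (cases "int n dvd (x - x') - f \<or> int n dvd (x' - x) - f \<or> int n dvd (y - y') - f \<or> int n dvd (y' - y) - f")
    case True
    have sh: "(y + b0) mod int n \<in> shift n b0 B" "(y' + b0) mod int n \<in> shift n b0 B"
      by (auto simp: shift_def B)
    have md: "int n dvd ((u + b0) mod int n - (v + b0) mod int n) - f" if "int n dvd (u - v) - f" for u v
    proof -
      have eq: "((u + b0) mod int n - (v + b0) mod int n) - f
          = (u - v) - f - int n * ((u + b0) div int n - (v + b0) div int n)"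
        by (simp add: algebra_simps flip: minus_mult_div_eq_mod)
      show ?thesis unfolding eq by (intro dvd_diff that dvd_triv_left)
    qed
    from True b0 sh md A show ?thesis by (metis UnCI insertCI)
  next
    case False
    \<comment> \<open>Once no pair has the difference \<open>f\<close>, three of the four conditions
      of \<open>place_pair\<close> hold in every orientation; only the last has to be
      checked.\<close>
    have place: ?thesis if uv: "u = x \<and> u' = x' \<or> u = x' \<and> u' = x"
      and vv: "v = y \<and> v' = y' \<or> v = y' \<and> v' = y"
      and nd: "\<not> int n dvd u + f - (v - v') - u'" for u u' v v'
    proof -
      have "\<not> int n dvd u + f - u'" "\<not> int n dvd f - (v - v')"
        using False uv vv dvd_minus_iff[of "int n" "u + f - u'"] dvd_minus_iff[of "int n" "f - (v - v')"]
        by (auto simp: algebra_simps)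
      then obtain b where b: "shift n b {v, v'} \<inter> {u, u'} = {}" "(u + f) mod int n \<in> shift n b {v, v'}"
        using place_pair[OF n _ _ f _ _ nd] uv x by metis
      have "{v, v'} = B" "{u, u'} = A" using uv vv A B by auto
      moreover have "((u + f) mod int n - u) - f = - int n * ((u + f) div int n)"
        by (simp add: algebra_simps flip: minus_mult_div_eq_mod)
      then have "int n dvd ((u + f) mod int n - u) - f" by simp
      ultimately show ?thesis using b by blast
    qed
    have "\<not> int n dvd x + f - (y - y') - x' \<or> \<not> int n dvd x' + f - (y - y') - x
      \<or> \<not> int n dvd x' + f - (y' - y) - x"
    proof (rule ccontr)
      assume "\<not> ?thesis"
      then have d: "int n dvd x + f - (y - y') - x'" "int n dvd x' + f - (y - y') - x"
        "int n dvd x' + f - (y' - y) - x" by auto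
      have "int n dvd 2 * (x - x')" using dvd_diff[OF d(1,2)] by (simp add: algebra_simps)
      moreover have "int n dvd 2 * f" using dvd_add[OF d(1,3)] by (simp add: algebra_simps)
      ultimately have "int n dvd (x - x') - f" using half_turn_unique al f by blast
      with False show False by blast
    qed
    then show ?thesis using place[of x x' y y'] place[of x' x y y'] place[of x' x y' y] by auto
  qed
  then show ?thesis using that unfolding f_def by blast
qed

section \<open>Row heights that can be packed\<close>

text \<open>Rotating columns controls only the sizes of the rows, so a packing is required for every
  choice of column sets with these sizes.\<close>

definition packs :: "nat \<Rightarrow> (int \<Rightarrow> nat) \<Rightarrow> bool" where
  "packs n h \<longleftrightarrow> (\<forall>A. (\<forall>r\<in>Z n. A r \<subseteq> Z n \<and> card (A r) = h r) \<longrightarrow>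
     (\<exists>a. disjoint_family_on (\<lambda>r. shift n (a r) (A r)) (Z n)))"

definition heavy :: "nat \<Rightarrow> (int \<Rightarrow> nat) \<Rightarrow> int set" where
  "heavy n h = {r \<in> Z n. 2 \<le> h r}"

definition larger :: "nat \<Rightarrow> (int \<Rightarrow> nat) \<Rightarrow> int \<Rightarrow> int set" where
  "larger n h r = {r' \<in> Z n - {r}. h r \<le> h r'}"

text \<open>Subtraction is truncated: an empty row contributes 0, and the defect is the number of
  positions minus the number of occupied rows.\<close>

definition defect :: "nat \<Rightarrow> (int \<Rightarrow> nat) \<Rightarrow> nat" where
  "defect n h = (\<Sum>r\<in>Z n. h r - 1)"

definition excess :: "nat \<Rightarrow> (int \<Rightarrow> nat) \<Rightarrow> nat" where
  "excess n h = (\<Sum>r\<in>Z n. h r - 2)"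

lemma finite_heavy [simp]: "finite (heavy n h)" and finite_larger [simp]: "finite (larger n h r)"
  by (simp_all add: heavy_def larger_def)

lemma packs_greedy:
  assumes "n > 0" "sum h (Z n) \<le> n"
    and "\<And>r. r \<in> heavy n h \<Longrightarrow> h r * sum h (larger n h r) < n"
  shows "packs n h"
  unfolding packs_def
proof (intro allI impI)
  fix A assume A: "\<forall>r\<in>Z n. A r \<subseteq> Z n \<and> card (A r) = h r"
  have "\<exists>a. (\<forall>r\<in>{}. a r = (0::int)) \<and> disjoint_family_on (\<lambda>r. shift n (a r) (A r)) ({} \<union> Z n)"
  proof (rule pack_extend)
    fix r assume r: "r \<in> Z n"
    have "{r' \<in> Z n - {r}. card (A r) \<le> card (A r')} = larger n h r"
      using A r by (auto simp: larger_def)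
    moreover have "(\<Sum>r'\<in>larger n h r. card (A r')) = sum h (larger n h r)"
      using A by (intro sum.cong) (auto simp: larger_def)
    moreover have "h r * sum h (larger n h r) < n"
    proof (cases "2 \<le> h r")
      case True
      then show ?thesis using assms(3) r by (simp add: heavy_def)
    next
      case False
      \<comment> \<open>A single position always fits: all other rows together occupy at most
        \<open>n - 1\<close> columns.\<close>
      have "h r + sum h (larger n h r) \<le> sum h (Z n)"
        using r by (subst sum.remove[of "Z n" r]) (auto simp: larger_def intro: sum_mono2)
      with False assms(1,2) show ?thesis by (cases "h r = 0") (auto simp: less_Suc_eq numeral_2_eq_2 not_le)
    qed
    ultimately show "card (A r) * ((\<Sum>r'\<in>{}. card (A r')) + (\<Sum>r'\<in>{r' \<in> Z n - {r}. card (A r) \<le> card (A r')}. card (A r'))) < n"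
      using A r by simp
  qed (use assms(1) A in \<open>auto simp: disjoint_family_on_def\<close>)
  then show "\<exists>a. disjoint_family_on (\<lambda>r. shift n (a r) (A r)) (Z n)" by auto
qed

text \<open>Covers the boundary of the greedy count, where the last pair \<open>r\<close> faces
  \<open>n / 2\<close> occupied columns. First \<open>p\<close> and \<open>q\<close> are placed so
  that two occupied columns repeat the difference of \<open>r\<close>; then come the other heavy
  rows, then \<open>r\<close>, then the single positions. The 4 in \<open>mid\<close> is the room
  taken by \<open>p\<close> and \<open>q\<close>.\<close>

lemma packs_pairs:
  assumes "n > 4" "sum h (Z n) \<le> n"
    and p: "p \<in> Z n" "h p = 2" and q: "q \<in> Z n" "h q = 2" and r: "r \<in> Z n" "h r = 2"
    and ne: "p \<noteq> q" "p \<noteq> r" "q \<noteq> r"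
    and last: "2 * (sum h (heavy n h) - 2) \<le> n"
    and mid: "\<And>u. u \<in> heavy n h - {p, q, r} \<Longrightarrow>
      h u * (4 + sum h (larger n h u - {p, q, r})) < n"
  shows "packs n h"
  unfolding packs_def
proof (intro allI impI)
  fix A assume A: "\<forall>r\<in>Z n. A r \<subseteq> Z n \<and> card (A r) = h r"
  define I where "I = heavy n h - {p, q, r}"
  define L where "L = Z n - heavy n h"
  have n: "n > 0" using assms(1) by simp
  have finI: "finite I" and subI: "I \<subseteq> Z n" by (auto simp: I_def heavy_def)
  have finL: "finite L" and subL: "L \<subseteq> Z n" by (auto simp: L_def)
  have sA: "A x \<subseteq> Z n" if "x \<in> Z n" for x using A that by blast
  have cA: "card (A x) = h x" if "x \<in> Z n" for x using A that by blast
  have sumA: "(\<Sum>x\<in>X. card (A x)) = sum h X" if "X \<subseteq> Z n" for X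
    using that cA by (intro sum.cong) auto
  have heavy: "heavy n h = insert r ({p, q} \<union> I)" "r \<notin> {p, q} \<union> I"
    using p q r ne by (auto simp: I_def heavy_def)
  have sum_heavy: "sum h (heavy n h) = 6 + sum h I"
  proof -
    have "sum h (heavy n h) = sum h I + sum h {p, q, r}"
      unfolding I_def using p q r by (intro sum.subset_diff) (auto simp: heavy_def)
    then show ?thesis using ne p q r by simp
  qed
  have "card (A r) = 2" using cA r by simp
  then obtain z z' where z: "A r = {z, z'}" "z \<noteq> z'" by (auto simp: card_2_iff)
  then have zZ: "z \<in> Z n" "z' \<in> Z n" using sA[OF r(1)] by auto
  obtain b o1 o2 where b: "shift n b (A q) \<inter> A p = {}" "o1 \<in> A p \<union> shift n b (A q)"
    "o2 \<in> A p \<union> shift n b (A q)" "int n dvd (o1 - o2) - (z - z')"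
    using pairs_coincide[OF assms(1) sA[OF p(1)] sA[OF q(1)] zZ z(2)] cA p q by metis
  define a0 where "a0 = (\<lambda>_. 0)(q := b)"
  have shp: "shift n 0 (A p) = A p"
    using sA[OF p(1)] unfolding shift_def by (auto simp: image_iff subset_iff)
  have "\<exists>a. (\<forall>x\<in>{p, q}. a x = a0 x) \<and> disjoint_family_on (\<lambda>x. shift n (a x) (A x)) ({p, q} \<union> I)"
  proof (rule pack_extend)
    show "disjoint_family_on (\<lambda>x. shift n (a0 x) (A x)) {p, q}"
      using b(1) ne shp by (auto simp: a0_def disjoint_family_on_def)
    fix u assume u: "u \<in> I"
    then have uZ: "u \<in> Z n" using subI by blast
    have "{x \<in> I - {u}. card (A u) \<le> card (A x)} = larger n h u - {p, q, r}"
      using u subI cA by (auto simp: larger_def I_def heavy_def)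
    then show "card (A u) * ((\<Sum>x\<in>{p, q}. card (A x)) + (\<Sum>x\<in>{x \<in> I - {u}. card (A u) \<le> card (A x)}. card (A x))) < n"
      using mid[of u] u uZ cA p q ne sumA[of "larger n h u - {p, q, r}"] by (simp add: I_def larger_def subset_iff)
  qed (use n finI subI sA p q in \<open>auto simp: I_def\<close>)
  then obtain a1 where a1: "a1 p = 0" "a1 q = b"
    "disjoint_family_on (\<lambda>x. shift n (a1 x) (A x)) ({p, q} \<union> I)"
    using ne by (auto simp: a0_def)
  define U where "U = (\<Union>x\<in>{p, q} \<union> I. shift n (a1 x) (A x))"
  have U: "U \<subseteq> Z n" using shift_subset[OF n] unfolding U_def by blast
  have "card U \<le> (\<Sum>x\<in>{p, q} \<union> I. card (shift n (a1 x) (A x)))"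
    unfolding U_def using finI by (intro card_UN_le) auto
  also have "\<dots> = sum h ({p, q} \<union> I)"
    using p q subI sA cA by (intro sum.cong) (auto simp: card_shift)
  also have "\<dots> = sum h (heavy n h) - 2"
    using heavy finI r by simp
  finally have "2 * card U \<le> n" using last by linarith
  \<comment> \<open>The repeated difference turns \<open>2 * card U \<le> n\<close> into fewer than
    \<open>n\<close> forbidden rotations.\<close>
  moreover have "o1 \<in> U" "o2 \<in> U" using b(2,3) a1 shp by (auto simp: U_def)
  then have "card (diffs n U (A r)) < card (A r) * card U"
    using card_diffs_coincide[of "A r" U o1 o2 z z' n] z b(4) U finite_subset[OF U] by auto
  ultimately have "card (diffs n U (A r)) < n" using cA r by simp
  then obtain c where c: "shift n c (A r) \<inter> U = {}"
    using shift_avoids[OF sA[OF r(1)] U] by blast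
  define a2 where "a2 = a1(r := c)"
  have a2: "disjoint_family_on (\<lambda>x. shift n (a2 x) (A x)) (heavy n h)"
  proof -
    have "disjoint_family_on (\<lambda>x. shift n (a2 x) (A x)) ({p, q} \<union> I)"
      using a1(3) heavy(2) unfolding disjoint_family_on_def a2_def by auto
    moreover have "(\<Union>x\<in>{p, q} \<union> I. shift n (a2 x) (A x)) = U"
      unfolding U_def a2_def using heavy(2) by (intro SUP_cong) auto
    ultimately show ?thesis
      using c unfolding heavy(1) disjoint_family_on_insert[OF heavy(2)]
      by (simp only: a2_def fun_upd_same)
  qed
  have "\<exists>a. (\<forall>x\<in>heavy n h. a x = a2 x) \<and> disjoint_family_on (\<lambda>x. shift n (a x) (A x)) (heavy n h \<union> L)"
  proof (rule pack_extend)
    fix u assume u: "u \<in> L"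
    then have uZ: "u \<in> Z n" "h u < 2" by (auto simp: L_def heavy_def)
    let ?P = "{x \<in> L - {u}. card (A u) \<le> card (A x)}"
    have "h u + (sum h (heavy n h) + sum h ?P) = sum h (insert u (heavy n h \<union> ?P))"
      using u finL by (subst sum.insert) (auto simp: L_def intro!: sum.union_disjoint[symmetric])
    also have "\<dots> \<le> sum h (Z n)"
      using uZ subL by (intro sum_mono2) (auto simp: heavy_def)
    finally have "h u * (sum h (heavy n h) + sum h ?P) < n"
      using assms(2) uZ n by (cases "h u = 0") (auto simp: less_Suc_eq numeral_2_eq_2 not_le)
    moreover have "heavy n h \<subseteq> Z n" "?P \<subseteq> Z n" using subL by (auto simp: heavy_def)
    ultimately show "card (A u) * ((\<Sum>x\<in>heavy n h. card (A x)) + (\<Sum>x\<in>?P. card (A x))) < n"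
      using uZ cA sumA by simp
  qed (use n finL a2 sA in \<open>auto simp: L_def heavy_def\<close>)
  moreover have "heavy n h \<union> L = Z n" by (auto simp: L_def heavy_def)
  ultimately show "\<exists>a. disjoint_family_on (\<lambda>r. shift n (a r) (A r)) (Z n)" by auto
qed

section \<open>Packing criteria in terms of the defect\<close>

lemma card_heavy: "card (heavy n h) + excess n h = defect n h"
proof -
  have "card (heavy n h) = (\<Sum>r\<in>Z n. if 2 \<le> h r then 1 else 0)"
    unfolding heavy_def by (simp add: sum.If_cases Int_def)
  then show ?thesis
    unfolding excess_def defect_def by (simp flip: sum.distrib) (intro sum.cong, auto)
qed

lemma sum_pred:
  fixes h :: "int \<Rightarrow> nat"
  assumes "finite P" "\<And>r. r \<in> P \<Longrightarrow> 0 < h r"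
  shows "sum h P = (\<Sum>r\<in>P. h r - 1) + card P"
proof -
  have "sum h P = (\<Sum>r\<in>P. (h r - 1) + 1)" using assms(2) by (intro sum.cong) auto
  then show ?thesis by (simp only: sum.distrib) simp
qed

text \<open>On a heavy row, \<open>h r + (h r - 2) = 2 * (h r - 1)\<close>.\<close>

lemma sum_heavy: "sum h (heavy n h) + excess n h = 2 * defect n h"
proof -
  have "(\<Sum>r\<in>heavy n h. h r - 1) = defect n h"
    unfolding defect_def heavy_def by (rule sum.mono_neutral_left) auto
  moreover have "sum h (heavy n h) = (\<Sum>r\<in>heavy n h. h r - 1) + card (heavy n h)"
    by (rule sum_pred) (auto simp: heavy_def)
  ultimately show ?thesis using card_heavy[of n h] by simp
qed

text \<open>The larger rows, \<open>r\<close> and \<open>Q\<close> are disjoint and share the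
  defect. \<open>Q\<close> stands for rows smaller than \<open>r\<close>, whose share is withheld
  from the larger ones.\<close>

lemma larger_defect:
  assumes "r \<in> heavy n h" "Q \<subseteq> Z n" "r \<notin> Q" "Q \<inter> larger n h r = {}"
  shows "(\<Sum>x\<in>larger n h r. h x - 1) + (h r - 1) + (\<Sum>x\<in>Q. h x - 1) \<le> defect n h"
    and "card (larger n h r) * (h r - 1) \<le> (\<Sum>x\<in>larger n h r. h x - 1)"
proof -
  have Q: "finite Q" using finite_subset[OF assms(2)] by simp
  have "(\<Sum>x\<in>larger n h r. h x - 1) + (h r - 1) + (\<Sum>x\<in>Q. h x - 1)
      = (\<Sum>x\<in>insert r (larger n h r \<union> Q). h x - 1)"
  proof -
    have "r \<notin> larger n h r \<union> Q" "larger n h r \<inter> Q = {}" using assms by (auto simp: larger_def)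
    then show ?thesis using Q by (simp add: sum.union_disjoint)
  qed
  also have "\<dots> \<le> defect n h"
    unfolding defect_def using assms by (intro sum_mono2) (auto simp: larger_def heavy_def)
  finally show "(\<Sum>x\<in>larger n h r. h x - 1) + (h r - 1) + (\<Sum>x\<in>Q. h x - 1) \<le> defect n h" .
  have "card (larger n h r) * (h r - 1) = (\<Sum>x\<in>larger n h r. h r - 1)" by simp
  also have "\<dots> \<le> (\<Sum>x\<in>larger n h r. h x - 1)"
    by (intro sum_mono) (auto simp: larger_def)
  finally show "card (larger n h r) * (h r - 1) \<le> (\<Sum>x\<in>larger n h r. h x - 1)" .
qed

lemma sum_larger:
  assumes "r \<in> heavy n h"
  shows "sum h (larger n h r) = (\<Sum>x\<in>larger n h r. h x - 1) + card (larger n h r)"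
  using assms by (intro sum_pred) (auto simp: larger_def heavy_def)

lemma sum_larger_le:
  assumes "r \<in> heavy n h" "Q \<subseteq> Z n" "r \<notin> Q" "Q \<inter> larger n h r = {}" "x \<le> (\<Sum>x\<in>Q. h x - 1)"
  defines "w \<equiv> defect n h + 1 - x - h r"
  shows "h r + x \<le> defect n h + 1" "sum h (larger n h r) \<le> w + w div (h r - 1)"
proof -
  let ?u = "\<Sum>x\<in>larger n h r. h x - 1"
  note b = larger_defect[OF assms(1-4)]
  have r: "2 \<le> h r" using assms(1) by (simp add: heavy_def)
  have "?u \<le> w" using b(1) assms(5) r unfolding w_def by linarith
  moreover from this b(2) have "card (larger n h r) \<le> w div (h r - 1)"
    using r by (subst less_eq_div_iff_mult_less_eq) auto
  ultimately show "sum h (larger n h r) \<le> w + w div (h r - 1)"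
    using sum_larger[OF assms(1)] by linarith
  show "h r + x \<le> defect n h + 1" using b(1) assms(5) r by linarith
qed

text \<open>If a row of size \<open>s\<close> leaves defect \<open>w\<close> for the rows of size at least \<open>s\<close> placed before it, then
  these are at most \<open>w div (s - 1)\<close> many and occupy at most \<open>w + w div (s - 1)\<close> columns.\<close>

definition fits :: "nat \<Rightarrow> nat \<Rightarrow> nat \<Rightarrow> bool" where
  "fits n w s \<longleftrightarrow> s * (w + w div (s - 1)) < n"

lemma fits_mono: "fits n w s \<Longrightarrow> w' \<le> w \<Longrightarrow> fits n w' s"
  unfolding fits_def by (meson add_mono_thms_linordered_semiring(1) div_le_mono le_less_trans mult_le_mono2)

text \<open>A row of size \<open>s\<close> uses \<open>s - 1\<close> of the defect, leaving at most
  \<open>t + 1 - s\<close> for the rows placed before it.\<close>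

lemma packs_if_small_defect:
  assumes "n > 0" "sum h (Z n) \<le> n" "defect n h \<le> t" "\<And>s. 2 \<le> s \<Longrightarrow> s \<le> t + 1 \<Longrightarrow> fits n (t + 1 - s) s"
  shows "packs n h"
proof (rule packs_greedy[OF assms(1,2)])
  fix r assume r: "r \<in> heavy n h"
  let ?w = "defect n h + 1 - 0 - h r"
  have b: "h r + 0 \<le> defect n h + 1" "sum h (larger n h r) \<le> ?w + ?w div (h r - 1)"
    using sum_larger_le[OF r, of "{}" 0] by auto
  have "fits n (t + 1 - h r) (h r)" using assms(3,4) r b(1) by (simp add: heavy_def)
  then have "fits n ?w (h r)" using assms(3) by (auto elim: fits_mono)
  with b(2) show "h r * sum h (larger n h r) < n"
    unfolding fits_def by (meson le_less_trans mult_le_mono2)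
qed

text \<open>By \<open>sum_heavy\<close>, a pair faces \<open>2 * defect - excess - 2\<close> columns
  of other heavy rows. If the excess is at least 2, this is below \<open>n / 2\<close> and the
  greedy order works. Otherwise all heavy rows except at most one of size 3 are pairs, and
  \<open>packs_pairs\<close> also handles equality.\<close>

lemma packs_if_few_pairs:
  assumes "n > 12" "sum h (Z n) \<le> n" "5 \<le> defect n h"
    and few: "4 * defect n h \<le> n + 4 + 2 * min 1 (excess n h)"
    and big: "\<And>r. r \<in> heavy n h \<Longrightarrow> 3 \<le> h r \<Longrightarrow> h r * sum h (larger n h r) < n"
  shows "packs n h"
proof (cases "excess n h \<le> 1")
  case False
  show ?thesis
  proof (rule packs_greedy)
    fix r assume r: "r \<in> heavy n h"
    show "h r * sum h (larger n h r) < n"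
    proof (cases "3 \<le> h r")
      case False
      with r have r2: "h r = 2" by (auto simp: heavy_def)
      have "sum h (larger n h r) + 2 = sum h (insert r (larger n h r))"
        using r2 by (subst sum.insert) (auto simp: larger_def)
      also have "insert r (larger n h r) = heavy n h" using r r2 by (auto simp: larger_def heavy_def)
      finally show ?thesis using \<open>\<not> excess n h \<le> 1\<close> sum_heavy[of h n] few r2 by simp
    qed (use big r in auto)
  qed (use assms in auto)
next
  case True
  have exc: "(\<Sum>x\<in>X. h x - 2) \<le> 1" if "X \<subseteq> Z n" for X
    using sum_mono2[OF finite_Z that, of "\<lambda>x. h x - 2"] True by (simp add: excess_def)
  have le3: "h x \<le> 3" if "x \<in> Z n" for x using exc[of "{x}"] that by simp
  define D where "D = {x \<in> heavy n h. h x = 2}"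
  have "card {x \<in> heavy n h. 3 \<le> h x} \<le> (\<Sum>x\<in>{x \<in> heavy n h. 3 \<le> h x}. h x - 2)"
    by (subst card_eq_sum) (intro sum_mono, auto)
  also have "\<dots> \<le> 1" by (rule exc) (auto simp: heavy_def)
  finally have "card {x \<in> heavy n h. 3 \<le> h x} \<le> 1" .
  moreover have "heavy n h = D \<union> {x \<in> heavy n h. 3 \<le> h x}" by (auto simp: D_def heavy_def)
  then have "card (heavy n h) \<le> card D + card {x \<in> heavy n h. 3 \<le> h x}" by (metis card_Un_le)
  \<comment> \<open>There are at least 4 heavy rows, and at most one of them is not a pair.\<close>
  ultimately have "3 \<le> card D" using card_heavy[of n h] True assms(3) by linarith
  then obtain E where "E \<subseteq> D" "card E = 3" by (meson obtain_subset_with_card_n)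
  then obtain p q r where pqr: "{p, q, r} \<subseteq> D" "p \<noteq> q" "p \<noteq> r" "q \<noteq> r"
    by (auto simp: card_3_iff)
  note sh = sum_heavy[of h n]
  show ?thesis
  proof (rule packs_pairs[of n h p q r])
    show "2 * (sum h (heavy n h) - 2) \<le> n" using sh few True by (simp add: min_def split: if_splits)
    fix u assume u: "u \<in> heavy n h - {p, q, r}"
    show "h u * (4 + sum h (larger n h u - {p, q, r})) < n"
    proof (cases "h u = 2")
      case True
      have "sum h {u, p, q, r} + sum h (larger n h u - {p, q, r}) =
          sum h ({u, p, q, r} \<union> (larger n h u - {p, q, r}))"
        using u by (intro sum.union_disjoint[symmetric]) (auto simp: larger_def)
      also have "\<dots> \<le> sum h (heavy n h)"
        using u pqr True by (intro sum_mono2) (auto simp: larger_def heavy_def D_def)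
      moreover have "sum h {u, p, q, r} = 8" using u pqr True by (auto simp: D_def)
      ultimately show ?thesis using True sh few by (simp add: min_def split: if_splits)
    next
      case False
      then have "3 \<le> h u" "u \<in> Z n" using u by (auto simp: heavy_def)
      have "larger n h u = {}"
      proof (rule ccontr)
        assume "larger n h u \<noteq> {}"
        then obtain v where "v \<in> Z n" "v \<noteq> u" "h u \<le> h v" by (auto simp: larger_def)
        with exc[of "{u, v}"] \<open>3 \<le> h u\<close> \<open>u \<in> Z n\<close> show False by simp
      qed
      \<comment> \<open>Only the four columns of \<open>p\<close> and \<open>q\<close> are occupied
        before this row of size 3, and \<open>3 * 4 < n\<close>.\<close>
      then show ?thesis using le3[OF \<open>u \<in> Z n\<close>] assms(1) by simp
    qed
  qed (use assms pqr in \<open>auto simp: D_def heavy_def\<close>)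
qed

section \<open>Row heights reached by rotating columns\<close>

definition attains :: "nat \<Rightarrow> (int \<Rightarrow> int set) \<Rightarrow> int set \<Rightarrow> (int \<Rightarrow> nat) \<Rightarrow> bool" where
  "attains n S K h \<longleftrightarrow> (\<exists>b. \<forall>r. h r = card {k \<in> K. r \<in> shift n (b k) (S k)})"

definition pile :: "int set \<Rightarrow> (int \<Rightarrow> nat) \<Rightarrow> int \<Rightarrow> nat" where
  "pile X h r = h r + of_bool (r \<in> X)"

definition occ :: "nat \<Rightarrow> (int \<Rightarrow> nat) \<Rightarrow> int set" where
  "occ n h = {r \<in> Z n. 0 < h r}"

lemma finite_occ [simp]: "finite (occ n h)"
  by (simp add: occ_def)

lemma attains_empty: "attains n S {} (\<lambda>_. 0)"
  by (simp add: attains_def)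

lemma attains_sum:
  assumes "n > 0" "finite K" "\<And>k. k \<in> K \<Longrightarrow> S k \<subseteq> Z n" "attains n S K h"
  shows "sum h (Z n) = (\<Sum>k\<in>K. card (S k))"
proof -
  obtain b where b: "\<And>r. h r = card {k \<in> K. r \<in> shift n (b k) (S k)}"
    using assms(4) by (auto simp: attains_def)
  have "h r = (\<Sum>k\<in>K. of_bool (r \<in> shift n (b k) (S k)))" for r
    using assms(2) by (simp add: b Int_def)
  then have "sum h (Z n) = (\<Sum>r\<in>Z n. \<Sum>k\<in>K. of_bool (r \<in> shift n (b k) (S k)))" by simp
  also have "\<dots> = (\<Sum>k\<in>K. \<Sum>r\<in>Z n. of_bool (r \<in> shift n (b k) (S k)))" by (rule sum.swap)
  also have "\<dots> = (\<Sum>k\<in>K. card (S k))"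
  proof (intro sum.cong refl)
    fix k assume "k \<in> K"
    have "Z n \<inter> {r. r \<in> shift n (b k) (S k)} = shift n (b k) (S k)"
      using shift_subset[OF assms(1)] by blast
    then show "(\<Sum>r\<in>Z n. of_bool (r \<in> shift n (b k) (S k))) = card (S k)"
      using card_shift[OF assms(3)[OF \<open>k \<in> K\<close>]] by simp
  qed
  finally show ?thesis .
qed

text \<open>The weight \<open>w\<close> is left open: it decides which rows the new column is kept
  away from.\<close>

lemma attains_light:
  assumes "n > 0" "finite K" "k \<notin> K" "S k \<subseteq> Z n" "attains n S K h"
  obtains X where "X \<subseteq> Z n" "card X = card (S k)" "attains n S (insert k K) (pile X h)"
    "sum w X \<le> card (S k) * sum w (Z n) div n"
proof -
  obtain b where b: "\<And>r. h r = card {k \<in> K. r \<in> shift n (b k) (S k)}"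
    using assms(5) by (auto simp: attains_def)
  obtain a where a: "sum w (shift n a (S k)) \<le> card (S k) * sum w (Z n) div n"
    using shift_light[OF assms(1,4)] .
  show ?thesis
  proof
    show "shift n a (S k) \<subseteq> Z n" by (rule shift_subset[OF assms(1)])
    show "card (shift n a (S k)) = card (S k)" by (rule card_shift[OF assms(4)])
    show "sum w (shift n a (S k)) \<le> card (S k) * sum w (Z n) div n" by (rule a)
    show "attains n S (insert k K) (pile (shift n a (S k)) h)"
      unfolding attains_def
    proof (intro exI[of _ "b(k := a)"] allI)
      fix r
      have "{k' \<in> insert k K. r \<in> shift n ((b(k := a)) k') (S k')} =
        (if r \<in> shift n a (S k) then insert k else id) {k \<in> K. r \<in> shift n (b k) (S k)}"
        using assms(3) by auto
      then show "pile (shift n a (S k)) h r = card {k' \<in> insert k K. r \<in> shift n ((b(k := a)) k') (S k')}"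
        using assms(2,3) by (simp add: pile_def b)
    qed
  qed
qed

lemma defect_occ: "defect n h + card (occ n h) = sum h (Z n)"
proof -
  have "card (occ n h) = (\<Sum>r\<in>Z n. of_bool (0 < h r))" by (simp add: occ_def Int_def)
  moreover have "sum h (Z n) = (\<Sum>r\<in>Z n. (h r - 1) + of_bool (0 < h r))" by (intro sum.cong) auto
  ultimately show ?thesis unfolding defect_def by (simp only: sum.distrib)
qed

lemma card_occ_add:
  assumes "X \<subseteq> Z n"
  shows "card (occ n (pile X h)) + card (X \<inter> occ n h) = card (occ n h) + card X"
proof -
  have "occ n (pile X h) = occ n h \<union> X" using assms by (auto simp: occ_def pile_def)
  then show ?thesis
    using card_Un_Int[of "occ n h" X] finite_subset[OF assms] by (simp add: Int_commute)
qed

text \<open>By averaging, some rotation of a column of size \<open>c\<close> meets at most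
  \<open>c * d div n\<close> of \<open>d\<close> occupied rows; this is the number of occupied rows
  then guaranteed.\<close>

definition covered :: "nat \<Rightarrow> nat \<Rightarrow> nat \<Rightarrow> nat" where
  "covered n d c = d + c - c * d div n"

text \<open>Since \<open>c \<le> n\<close>, the quotient grows no faster than \<open>d\<close>.
  Hence lower bounds on the number of occupied rows can be chained.\<close>

lemma covered_mono:
  assumes "d \<le> d'" "c \<le> n" "n > 0"
  shows "covered n d c \<le> covered n d' c"
proof -
  have "c * d' \<le> c * d + n * (d' - d)"
    using assms by (metis add_left_mono distrib_left le_add_diff_inverse mult_le_mono1)
  then have "c * d' div n \<le> (c * d + n * (d' - d)) div n" by (rule div_le_mono)
  also have "\<dots> = c * d div n + (d' - d)" using assms(3) by simp
  finally show ?thesis using assms(1) unfolding covered_def by linarith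
qed

lemma attains_covered:
  assumes "n > 0" "finite K" "k \<notin> K" "S k \<subseteq> Z n" "attains n S K h" "d \<le> card (occ n h)"
  obtains h' where "attains n S (insert k K) h'" "covered n d (card (S k)) \<le> card (occ n h')"
proof -
  let ?w = "\<lambda>r. of_bool (r \<in> occ n h) :: nat"
  obtain X where X: "X \<subseteq> Z n" "card X = card (S k)" "attains n S (insert k K) (pile X h)"
    "sum ?w X \<le> card (S k) * sum ?w (Z n) div n"
    using attains_light[OF assms(1-5)] .
  have fin: "finite X" using finite_subset[OF X(1)] by simp
  have "sum ?w X = card (X \<inter> occ n h)" using fin by simp
  moreover have "sum ?w (Z n) = card (occ n h)"
    by (simp add: Int_absorb1 occ_def Int_def)
  ultimately have "card (X \<inter> occ n h) \<le> card (S k) * card (occ n h) div n" using X(4) by metis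
  then have "covered n (card (occ n h)) (card (S k)) \<le> card (occ n (pile X h))"
    using card_occ_add[OF X(1), of h] X(2) unfolding covered_def by linarith
  moreover have "card (S k) \<le> n" using card_mono[OF finite_Z assms(4)] by simp
  ultimately show ?thesis
    using that[OF X(3)] covered_mono[OF assms(6) _ assms(1)] le_trans by blast
qed

text \<open>Size lists are read from the right: the head belongs to the column placed last.\<close>

fun cover :: "nat \<Rightarrow> nat list \<Rightarrow> nat" where
  "cover n [] = 0"
| "cover n (c # cs) = covered n (cover n cs) c"

lemma attains_cover:
  assumes "n > 0" "distinct ks" "\<And>k. k \<in> set ks \<Longrightarrow> S k \<subseteq> Z n"
  shows "\<exists>h. attains n S (set ks) h \<and> cover n (map (\<lambda>k. card (S k)) ks) \<le> card (occ n h)"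
  using assms(2,3)
proof (induction ks)
  case Nil
  then show ?case using attains_empty by auto
next
  case (Cons k ks)
  then obtain h where "attains n S (set ks) h" "cover n (map (\<lambda>k. card (S k)) ks) \<le> card (occ n h)"
    by auto
  then show ?case
    using attains_covered[OF assms(1) finite_set, of k ks S h] Cons.prems by fastforce
qed

text \<open>While fewer than \<open>n\<close> rows are occupied, a single position meets on average
  less than one of them, so some rotation puts it on an empty row.\<close>

lemma attains_singles:
  assumes "n > 0" "finite K" "attains n S K h" "finite J" "J \<inter> K = {}"
    and "\<And>k. k \<in> K \<union> J \<Longrightarrow> S k \<subseteq> Z n" "\<And>k. k \<in> J \<Longrightarrow> card (S k) \<le> 1"
    and "(\<Sum>k\<in>K \<union> J. card (S k)) \<le> n"
  shows "\<exists>X. X \<subseteq> Z n - occ n h \<and> attains n S (K \<union> J) (pile X h)"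
  using assms(4-8)
proof (induction J)
  case empty
  then show ?case using assms(3) by (auto intro!: exI[of _ "{}"] simp: pile_def[abs_def])
next
  case (insert k J)
  have sum: "(\<Sum>k\<in>K \<union> insert k J. card (S k)) = card (S k) + (\<Sum>k\<in>K \<union> J. card (S k))"
    using insert assms(2) by simp
  then obtain X where X: "X \<subseteq> Z n - occ n h" "attains n S (K \<union> J) (pile X h)"
    using insert by auto
  let ?h = "pile X h"
  let ?w = "\<lambda>r. of_bool (r \<in> occ n ?h) :: nat"
  have k: "finite (K \<union> J)" "k \<notin> K \<union> J" "S k \<subseteq> Z n" using insert assms(2) by auto
  obtain Y where Y: "Y \<subseteq> Z n" "card Y = card (S k)" "attains n S (insert k (K \<union> J)) (pile Y ?h)"
    "sum ?w Y \<le> card (S k) * sum ?w (Z n) div n"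
    using attains_light[OF assms(1) k X(2)] .
  have fin: "finite Y" using finite_subset[OF Y(1)] by simp
  have "Y \<inter> occ n ?h = {}"
  proof (cases "card (S k) = 0")
    case True
    then show ?thesis using Y(2) fin by simp
  next
    case False
    then have one: "card (S k) = 1" using insert.prems(3)[of k] by simp
    have "sum ?w (Z n) = card (occ n ?h)"
      by (simp add: Int_absorb1 occ_def Int_def)
    also have "\<dots> \<le> sum ?h (Z n)" using defect_occ[of n ?h] by simp
    also have "\<dots> = (\<Sum>k\<in>K \<union> J. card (S k))"
      using insert.prems(2) by (intro attains_sum[OF assms(1) k(1) _ X(2)]) auto
    also have "\<dots> < n" using insert.prems(4) sum one by simp
    finally have "sum ?w Y = 0" using Y(4) one by simp
    then show ?thesis using fin by auto
  qed
  then have "Y \<inter> X = {}" "Y \<inter> occ n h = {}" using X(1) by (auto simp: occ_def pile_def)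
  then have "pile Y ?h = pile (X \<union> Y) h" by (auto simp: pile_def fun_eq_iff)
  with Y \<open>Y \<inter> occ n h = {}\<close> X(1) show ?case by (intro exI[of _ "X \<union> Y"]) auto
qed

section \<open>From packed rows to a VH-shuffle\<close>

lemma H_graph_if_inj:
  assumes "inj_on fst G" "fst ` G = {0..<int n}" "snd ` G \<subseteq> {0..<int n}"
  shows "H_graph n G"
  unfolding H_graph_def
proof (intro exI conjI)
  define x where "x k = snd (inv_into G fst k)" for k
  have x: "inv_into G fst k \<in> G" "fst (inv_into G fst k) = k" if "k \<in> {0..<int n}" for k
    using that assms(2) by (metis inv_into_into, metis f_inv_into_f)
  show "\<forall>k\<in>{0..<int n}. x k \<in> {0..<int n}"
    using x(1) assms(3) unfolding x_def by blast
  show "G = {(k, x k) |k. k \<in> {0..<int n}}"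
  proof (intro equalityI subsetI)
    fix g assume g: "g \<in> G"
    then have "inv_into G fst (fst g) = g" using assms(1) by simp
    then have "g = (fst g, x (fst g))" by (simp add: x_def)
    moreover have "fst g \<in> {0..<int n}" using g assms(2) by blast
    ultimately show "g \<in> {(k, x k) |k. k \<in> {0..<int n}}" by blast
  next
    fix g assume "g \<in> {(k, x k) |k. k \<in> {0..<int n}}"
    then obtain k where k: "g = (k, x k)" "k \<in> {0..<int n}" by blast
    then have "g = inv_into G fst k" using x(2) by (simp add: x_def prod_eq_iff)
    then show "g \<in> G" using x(1) k(2) by simp
  qed
qed

text \<open>After the V-move, row \<open>r\<close> holds the columns \<open>A r\<close>. Disjoint
  translates of these sets make the column coordinate injective on the image of \<open>P\<close>,
  and \<open>n\<close> distinct values fill \<open>Z n\<close>.\<close>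

lemma shuffle_if_packs:
  assumes "n > 0" "P \<subseteq> square n" "card P = n"
    and S: "S = (\<lambda>k. {r. (k, r) \<in> P})" and "attains n S (Z n) h" "packs n h"
  shows "\<exists>\<sigma>. VH_shuffle n \<sigma> \<and> H_graph n (\<sigma> ` P)"
proof -
  obtain b where b: "\<And>r. h r = card {k \<in> Z n. r \<in> shift n (b k) (S k)}"
    using assms(5) by (auto simp: attains_def)
  define A where "A r = {k \<in> Z n. r \<in> shift n (b k) (S k)}" for r
  obtain a where a: "disjoint_family_on (\<lambda>r. shift n (a r) (A r)) (Z n)"
    using assms(6) b unfolding packs_def A_def by fastforce
  obtain v where v: "V_move n v" "\<forall>(k, r) \<in> square n. v (k, r) = (k, (r + b k) mod int n)"
    using V_move_exists by blast
  obtain g where g: "H_move n g" "\<forall>(k, r) \<in> square n. g (k, r) = ((k + a r) mod int n, r)"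
    using H_move_exists by blast
  define f where "f k r = (r + b k) mod int n" for k r
  have img: "(g \<circ> v) (k, r) = ((k + a (f k r)) mod int n, f k r)" if "(k, r) \<in> P" for k r
  proof -
    have "(k, r) \<in> square n" "(k, f k r) \<in> square n"
      using that assms(1,2) by (auto simp: square_def f_def)
    then show ?thesis
      using bspec[OF v(2), of "(k, r)"] bspec[OF g(2), of "(k, f k r)"] by (simp add: f_def)
  qed
  have mem: "k \<in> A (f k r)" "f k r \<in> Z n" "k \<in> Z n" "r \<in> Z n" if "(k, r) \<in> P" for k r
    using that assms(1,2) by (auto simp: A_def f_def S square_def shift_def Z_def)
  have inj: "k = k' \<and> r = r'" if "(k, r) \<in> P" "(k', r') \<in> P"
    "(k + a (f k r)) mod int n = (k' + a (f k' r')) mod int n" for k r k' r'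
  proof -
    have "(k + a (f k r)) mod int n \<in> shift n (a (f k r)) (A (f k r))"
      "(k' + a (f k' r')) mod int n \<in> shift n (a (f k' r')) (A (f k' r'))"
      using mem[OF that(1)] mem[OF that(2)] unfolding shift_def by blast+
    with a that mem have eq: "f k r = f k' r'"
      unfolding disjoint_family_on_def by (metis IntI empty_iff)
    then have "k = k'" using inj_onD[OF inj_on_shift that(3)[unfolded eq]] mem that by blast
    moreover from this have "r = r'"
      using eq inj_onD[OF inj_on_shift[of "b k" n], of r r'] mem that by (simp add: f_def)
    ultimately show ?thesis by blast
  qed
  have inj_fst: "inj_on (\<lambda>p. fst ((g \<circ> v) p)) P"
  proof (rule inj_onI)
    fix p q assume "p \<in> P" "q \<in> P" "fst ((g \<circ> v) p) = fst ((g \<circ> v) q)"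
    then show "p = q" using inj img by (cases p; cases q) (simp del: comp_apply)
  qed
  have sub: "fst ((g \<circ> v) p) \<in> Z n \<and> snd ((g \<circ> v) p) \<in> Z n" if "p \<in> P" for p
    using that img mem assms(1) by (cases p) (simp del: comp_apply)
  have "(\<lambda>p. fst ((g \<circ> v) p)) ` P = Z n"
    using sub card_image[OF inj_fst] assms(3) by (intro card_subset_eq) auto
  then have "fst ` (g \<circ> v) ` P = {0..<int n}" by (simp add: image_image Z_def)
  moreover have "inj_on fst ((g \<circ> v) ` P)"
    using inj_fst by (auto simp: inj_on_def)
  moreover have "snd ` (g \<circ> v) ` P \<subseteq> {0..<int n}" using sub by (auto simp: Z_def)
  ultimately have "H_graph n ((g \<circ> v) ` P)" by (intro H_graph_if_inj)
  then show ?thesis using v g unfolding VH_shuffle_def by blast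
qed

section \<open>Control over the rows that are met\<close>

text \<open>The columns with one position are placed last, each on an empty row of its own; \<open>X\<close> collects
  those rows.\<close>

definition packable :: "nat \<Rightarrow> (int \<Rightarrow> nat) \<Rightarrow> bool" where
  "packable n h \<longleftrightarrow> (\<forall>X \<subseteq> Z n - occ n h. sum (pile X h) (Z n) \<le> n \<longrightarrow> packs n (pile X h))"

lemma defect_pile:
  assumes "X \<subseteq> Z n"
  shows "defect n (pile X h) = defect n h + card (X \<inter> occ n h)"
proof -
  have "card (X \<inter> occ n h) = (\<Sum>r\<in>Z n. of_bool (r \<in> X \<inter> occ n h))"
    using assms by (auto simp: occ_def intro!: arg_cong[where f = card])
  moreover have "defect n (pile X h) = (\<Sum>r\<in>Z n. (h r - 1) + of_bool (r \<in> X \<inter> occ n h))"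
    unfolding defect_def by (intro sum.cong) (auto simp: pile_def occ_def)
  ultimately show ?thesis unfolding defect_def by (simp only: sum.distrib)
qed

context
  fixes n h X
  assumes X: "X \<subseteq> Z n - occ n h"
begin

text \<open>Rows of \<open>X\<close> were empty and get height 1. So heavy rows, defect and excess
  stay the same, and packing can be judged before the single positions are placed.\<close>

lemma pile_heavy: "heavy n (pile X h) = heavy n h"
  using X by (auto simp: heavy_def pile_def occ_def)

lemma pile_on_heavy: "r \<in> heavy n h \<Longrightarrow> pile X h r = h r"
  using X by (auto simp: heavy_def pile_def occ_def)

lemma pile_excess: "excess n (pile X h) = excess n h"
  unfolding excess_def using X by (intro sum.cong) (auto simp: pile_def occ_def)

lemma pile_defect: "defect n (pile X h) = defect n h"
proof -
  have "X \<inter> occ n h = {}" "X \<subseteq> Z n" using X by auto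
  then show ?thesis by (simp add: defect_pile)
qed

lemma pile_larger:
  assumes "r \<in> heavy n h"
  shows "larger n (pile X h) r = larger n h r"
    and "sum (pile X h) (larger n h r) = sum h (larger n h r)"
proof -
  show "larger n (pile X h) r = larger n h r"
    using assms X by (auto simp: larger_def heavy_def pile_def occ_def)
  show "sum (pile X h) (larger n h r) = sum h (larger n h r)"
    using assms by (intro sum.cong pile_on_heavy) (auto simp: larger_def heavy_def)
qed

end

lemma packable_if_small_defect:
  assumes "n > 0" "defect n h \<le> t" "\<And>s. 2 \<le> s \<Longrightarrow> s \<le> t + 1 \<Longrightarrow> fits n (t + 1 - s) s"
  shows "packable n h"
  unfolding packable_def using assms pile_defect[of _ n h]
  by (auto intro!: packs_if_small_defect[of n _ t])

lemma packable_if_few_pairs: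
  assumes "n > 12" "5 \<le> defect n h" "4 * defect n h \<le> n + 4 + 2 * min 1 (excess n h)"
    and "\<And>r. r \<in> heavy n h \<Longrightarrow> 3 \<le> h r \<Longrightarrow> h r * sum h (larger n h r) < n"
  shows "packable n h"
  unfolding packable_def
proof (intro allI impI)
  fix X assume X: "X \<subseteq> Z n - occ n h" and sum: "sum (pile X h) (Z n) \<le> n"
  show "packs n (pile X h)"
  proof (rule packs_if_few_pairs[OF assms(1) sum])
    fix r assume "r \<in> heavy n (pile X h)" "3 \<le> pile X h r"
    then show "pile X h r * sum (pile X h) (larger n (pile X h) r) < n"
      using assms(4)[of r] X by (simp add: pile_heavy pile_on_heavy pile_larger)
  qed (use assms X in \<open>simp_all add: pile_defect pile_excess\<close>)
qed

lemma packable_if_fits: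
  assumes "n > 12" "5 \<le> defect n h" "4 * defect n h \<le> n + 4"
    and "\<And>s. 3 \<le> s \<Longrightarrow> s \<le> defect n h + 1 \<Longrightarrow> fits n (defect n h + 1 - s) s"
  shows "packable n h"
proof (rule packable_if_few_pairs)
  fix r assume r: "r \<in> heavy n h" "3 \<le> h r"
  let ?w = "defect n h + 1 - 0 - h r"
  have b: "h r + 0 \<le> defect n h + 1" "sum h (larger n h r) \<le> ?w + ?w div (h r - 1)"
    using sum_larger_le[OF r(1), of "{}" 0] by auto
  then have "fits n ?w (h r)" using assms(4) r(2) by auto
  with b(2) show "h r * sum h (larger n h r) < n"
    unfolding fits_def by (meson le_less_trans mult_le_mono2)
qed (use assms in auto)

text \<open>Row \<open>q\<close> makes the excess positive, which gains 2 in the bound on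
  \<open>4 * defect n h\<close>. The pair \<open>p\<close> withholds 1 of the defect from rows of
  size at least 3, hence \<open>defect n h - s\<close> instead of
  \<open>defect n h + 1 - s\<close>.\<close>

lemma packable_if_pair_and_triple:
  assumes "n > 12" "5 \<le> defect n h" "4 * defect n h \<le> n + 6"
    and "q \<in> Z n" "3 \<le> h q" "p \<in> Z n" "h p = 2"
    and "\<And>s. 3 \<le> s \<Longrightarrow> s \<le> defect n h \<Longrightarrow> fits n (defect n h - s) s"
  shows "packable n h"
proof (rule packable_if_few_pairs)
  have "h q - 2 \<le> excess n h" unfolding excess_def using assms(4) by (intro member_le_sum) auto
  then show "4 * defect n h \<le> n + 4 + 2 * min 1 (excess n h)" using assms(3,5) by simp
  fix r assume r: "r \<in> heavy n h" "3 \<le> h r"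
  let ?w = "defect n h + 1 - 1 - h r"
  have p: "{p} \<subseteq> Z n" "r \<notin> {p}" "{p} \<inter> larger n h r = {}" "1 \<le> (\<Sum>x\<in>{p}. h x - 1)"
    using assms(6,7) r(2) by (auto simp: larger_def)
  note b = sum_larger_le[OF r(1) p]
  then have "fits n ?w (h r)" using assms(8) r(2) by auto
  with b(2) show "h r * sum h (larger n h r) < n"
    unfolding fits_def by (meson le_less_trans mult_le_mono2)
qed (use assms in auto)

text \<open>With defect 9 on 32 columns, three rows of height 4 are the only heights that
  the counting bounds cannot pack.\<close>

lemma packable_32:
  assumes "defect 32 h = 9" "q \<in> heavy 32 h" "h q \<noteq> 4"
  shows "packable 32 h"
proof (rule packable_if_few_pairs)
  fix r assume r: "r \<in> heavy 32 h" "3 \<le> h r"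
  let ?w = "defect 32 h + 1 - 0 - h r"
  have b: "h r + 0 \<le> defect 32 h + 1" "sum h (larger 32 h r) \<le> ?w + ?w div (h r - 1)"
    using sum_larger_le[OF r(1), of "{}" 0] by auto
  show "h r * sum h (larger 32 h r) < 32"
  proof (cases "h r = 4")
    case False
    have "h r \<in> {3, 5, 6, 7, 8, 9, 10}" using r(2) b(1) False assms(1) by auto
    then have "fits 32 ?w (h r)" using assms(1) by (auto simp: fits_def)
    with b(2) show ?thesis unfolding fits_def by (meson le_less_trans mult_le_mono2)
  next
    case True
    have qZ: "q \<in> Z 32" "q \<noteq> r" using assms(2,3) True by (auto simp: heavy_def)
    let ?u = "\<Sum>x\<in>larger 32 h r. h x - 1"
    \<comment> \<open>Row \<open>r\<close> leaves 6 of the defect 9. If \<open>q\<close> is larger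
      than \<open>r\<close>, it takes at least 4, and no further row of size at least 4 fits; if
      smaller, it takes at least 1, and at most one such row fits.\<close>
    have small: "?u + card (larger 32 h r) \<le> 7"
    proof (cases "q \<in> larger 32 h r")
      case True
      then have "5 \<le> h q" using assms(3) \<open>h r = 4\<close> by (auto simp: larger_def)
      then have "4 \<le> h q - 1" by simp
      moreover have "?u = (h q - 1) + (\<Sum>x\<in>larger 32 h r - {q}. h x - 1)"
        using True by (subst sum.remove) auto
      moreover have "(\<Sum>x\<in>larger 32 h r - {q}. 3) \<le> (\<Sum>x\<in>larger 32 h r - {q}. h x - 1)"
        using \<open>h r = 4\<close> by (intro sum_mono) (auto simp: larger_def)
      moreover have "card (larger 32 h r) = card (larger 32 h r - {q}) + 1"
        using card.remove[OF finite_larger True] by simp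
      ultimately show ?thesis
        using larger_defect(1)[OF r(1), of "{}"] assms(1) \<open>h r = 4\<close> by simp
    next
      case False
      then show ?thesis
        using larger_defect[OF r(1), of "{q}"] qZ assms(1,2) \<open>h r = 4\<close> by (auto simp: heavy_def)
    qed
    then show ?thesis using sum_larger[OF r(1)] True by simp
  qed
qed (use assms in auto)

section \<open>Steering a rotation by weighted averages\<close>

lemma sum_indicator:
  assumes "Y \<subseteq> Z n" "X \<subseteq> Z n"
  shows "(\<Sum>r\<in>X. of_bool (r \<in> Y)) = card (X \<inter> Y)"
  using finite_subset[OF assms(2)] by simp

lemma defect_as_heavy: "defect n h = (\<Sum>r\<in>heavy n h. h r - 1)"
  unfolding defect_def heavy_def by (rule sum.mono_neutral_right) auto

lemma card_heavy_le: "(\<And>r. r \<in> heavy n h \<Longrightarrow> m \<le> h r - 1) \<Longrightarrow> m * card (heavy n h) \<le> defect n h"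
  unfolding defect_as_heavy using sum_mono[of "heavy n h" "\<lambda>_. m" "\<lambda>r. h r - 1"] by (simp add: mult.commute)

context
  fixes n :: nat and S :: "int \<Rightarrow> int set" and K :: "int set" and k :: int and h :: "int \<Rightarrow> nat"
  assumes n: "n > 0" and K: "finite K" "k \<notin> K" "S k \<subseteq> Z n" and h: "attains n S K h"
begin

text \<open>The average runs over the occupied rows except one heavy row \<open>q\<close>. If
  \<open>f\<close> occupied rows are still met, \<open>q\<close> is among them and reaches height 3.
  If the defect is below \<open>f\<close>, there are fewer than \<open>f\<close> heavy rows, so a
  row of height 1 is met as well and becomes a pair.\<close>

lemma attains_hitting_heavy:
  assumes "card (S k) * (card (occ n h) - 1) div n < f" "defect n h > 0"
  obtains h' where "attains n S (insert k K) h'" "defect n h' < defect n h + f"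
  | h' q where "attains n S (insert k K) h'" "defect n h' = defect n h + f" "q \<in> Z n" "3 \<le> h' q"
      "defect n h < f \<Longrightarrow> \<exists>p\<in>Z n. h' p = 2"
proof -
  have "heavy n h \<noteq> {}" using assms(2) by (auto simp: defect_as_heavy)
  then obtain q where q: "q \<in> heavy n h" by blast
  then have qo: "q \<in> occ n h" by (auto simp: heavy_def occ_def)
  let ?Y = "occ n h - {q}"
  have Y: "?Y \<subseteq> Z n" by (auto simp: occ_def)
  obtain X where X: "X \<subseteq> Z n" "card X = card (S k)" "attains n S (insert k K) (pile X h)"
    "(\<Sum>r\<in>X. of_bool (r \<in> ?Y)) \<le> card (S k) * (\<Sum>r\<in>Z n. of_bool (r \<in> ?Y)) div n"
    using attains_light[OF n K h] .
  have fin: "finite X" using finite_subset[OF X(1)] by simp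
  have "card (Z n \<inter> ?Y) = card (occ n h) - 1" using Y qo by (simp add: Int_absorb1)
  then have "card (X \<inter> ?Y) \<le> card (S k) * (card (occ n h) - 1) div n"
    using X(4) unfolding sum_indicator[OF Y X(1)] sum_indicator[OF Y order_refl] by simp
  then have le: "card (X \<inter> ?Y) < f" using assms(1) by linarith
  have d: "defect n (pile X h) = defect n h + card (X \<inter> occ n h)" by (rule defect_pile[OF X(1)])
  show ?thesis
  proof (cases "card (X \<inter> occ n h) < f")
    case True
    then show ?thesis using that(1)[OF X(3)] d by simp
  next
    case False
    have "q \<in> X"
    proof (rule ccontr)
      assume "q \<notin> X"
      then have "X \<inter> occ n h = X \<inter> ?Y" by auto
      with False le show False by simp
    qed
    then have "X \<inter> occ n h = insert q (X \<inter> ?Y)" using qo by auto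
    then have "card (X \<inter> occ n h) \<le> card (X \<inter> ?Y) + 1" using fin by simp
    with le False have N: "card (X \<inter> occ n h) = f" by simp
    show ?thesis
    proof (rule that(2)[OF X(3)])
      show "q \<in> Z n" "3 \<le> pile X h q" using q \<open>q \<in> X\<close> by (auto simp: heavy_def pile_def)
      assume "defect n h < f"
      moreover have "card (heavy n h) \<le> defect n h" using card_heavy[of n h] by simp
      ultimately have "\<not> X \<inter> occ n h \<subseteq> heavy n h"
        using N card_mono[OF finite_heavy, of "X \<inter> occ n h" n h] by linarith
      then obtain p where "p \<in> X" "p \<in> occ n h" "p \<notin> heavy n h" by blast
      then show "\<exists>p\<in>Z n. pile X h p = 2" by (auto simp: occ_def heavy_def pile_def intro!: bexI[of _ p])
    qed (use d N in simp)
  qed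
qed

text \<open>With weight 2 on \<open>q\<close> and 1 on the other occupied rows, a rotation of weight
  at most \<open>f\<close> that meets \<open>f\<close> occupied rows must miss
  \<open>q\<close>.\<close>

lemma attains_missing_heavy:
  assumes "card (S k) * (card (occ n h) + 1) div n \<le> f" "q \<in> heavy n h"
  obtains h' where "attains n S (insert k K) h'" "defect n h' < defect n h + f"
  | X where "attains n S (insert k K) (pile X h)" "defect n (pile X h) = defect n h + f"
      "X \<subseteq> Z n" "q \<notin> X" "card (X \<inter> occ n h) = f"
proof -
  have qo: "q \<in> occ n h" using assms(2) by (auto simp: heavy_def occ_def)
  let ?w = "\<lambda>r. of_bool (r \<in> occ n h) + of_bool (r \<in> {q}) :: nat"
  have Y: "occ n h \<subseteq> Z n" "{q} \<subseteq> Z n" using qo by (auto simp: occ_def)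
  obtain X where X: "X \<subseteq> Z n" "card X = card (S k)" "attains n S (insert k K) (pile X h)"
    "sum ?w X \<le> card (S k) * sum ?w (Z n) div n"
    using attains_light[OF n K h] .
  have w: "sum ?w V = card (V \<inter> occ n h) + card (V \<inter> {q})" if "V \<subseteq> Z n" for V
    using sum_indicator[OF Y(1) that] sum_indicator[OF Y(2) that] by (simp only: sum.distrib)
  have "sum ?w (Z n) = card (occ n h) + 1" using Y by (simp only: w[OF order_refl]) (simp add: Int_absorb1)
  then have le: "card (X \<inter> occ n h) + card (X \<inter> {q}) \<le> f" using X(4) assms(1) w[OF X(1)] by simp
  have d: "defect n (pile X h) = defect n h + card (X \<inter> occ n h)" by (rule defect_pile[OF X(1)])
  show ?thesis
  proof (cases "card (X \<inter> occ n h) < f")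
    case True
    then show ?thesis using that(1)[OF X(3)] d by simp
  next
    case False
    with le have "card (X \<inter> {q}) = 0" "card (X \<inter> occ n h) = f" by auto
    then show ?thesis using that(2)[OF X(3) _ X(1)] d by simp
  qed
qed

lemma attains_pair_and_triple:
  assumes "card (S k) * (card (occ n h) + 1) div n \<le> 3" "defect n h = 6" "t \<in> Z n" "3 \<le> h t"
  obtains h' where "attains n S (insert k K) h'" "defect n h' \<le> 8"
  | h' p q where "attains n S (insert k K) h'" "defect n h' = 9" "q \<in> Z n" "3 \<le> h' q" "p \<in> Z n" "h' p = 2"
proof -
  \<comment> \<open>An existing pair is spared and survives. Without one, all heavy rows have size
    at least 3, so defect 6 allows three at most; with one spared, the three meetings must include a
    row of height 1, which becomes a pair.\<close>
  define q where "q = (if \<exists>p\<in>Z n. h p = 2 then SOME p. p \<in> Z n \<and> h p = 2 else t)"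
  have q: "q \<in> Z n" "h q = 2 \<or> q = t \<and> \<not> (\<exists>p\<in>Z n. h p = 2)"
    using someI_ex[of "\<lambda>p. p \<in> Z n \<and> h p = 2"] assms(3) unfolding q_def by (auto split: if_splits)
  then have "q \<in> heavy n h" using assms(3,4) by (auto simp: heavy_def)
  from attains_missing_heavy[OF assms(1) this] show ?thesis
  proof cases
    case (1 h')
    then show ?thesis using that(1) assms(2) by simp
  next
    case (2 X)
    have t: "3 \<le> pile X h t" using assms(4) by (simp add: pile_def)
    have "\<exists>p\<in>Z n. pile X h p = 2"
    proof (cases "h q = 2")
      case True
      then show ?thesis using q(1) 2(4) by (auto simp: pile_def)
    next
      case False
      have "2 * card (heavy n h) \<le> defect n h"
        using q False by (intro card_heavy_le) (force simp: heavy_def)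
      then have "card (heavy n h - {q}) < 3"
        using assms(2) \<open>q \<in> heavy n h\<close> by simp
      then have "\<not> X \<inter> occ n h \<subseteq> heavy n h - {q}"
        using 2(5) card_mono[of "heavy n h - {q}" "X \<inter> occ n h"] by auto
      then obtain p where "p \<in> X" "p \<in> occ n h" "p \<notin> heavy n h" using 2(4) by blast
      then show ?thesis by (auto simp: occ_def heavy_def pile_def intro!: bexI[of _ p])
    qed
    then show ?thesis using that(2)[OF 2(1) _ assms(3) t] 2(2) assms(2) by auto
  qed
qed

end

section \<open>Search through the column sizes\<close>

text \<open>Defects up to \<open>(n + 3) div 4\<close> are packed greedily. For 20, 24 and 28 the
  separate treatment of pairs reaches \<open>(n + 4) div 4\<close>, one more; for 32 that value
  needs \<open>cond32\<close>.\<close>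

definition tol :: "nat \<Rightarrow> nat" where
  "tol n = (n + 3) div 4 + (if n = 20 \<or> n = 24 \<or> n = 28 then 1 else 0)"

text \<open>The last column has size \<open>c\<close>; the columns before it have \<open>m\<close> positions and occupy \<open>d\<close> rows. The
  final heights must not be three times 4. Meeting four rows rules this out. Otherwise a rotation
  spares some row of size at least 2: a row of size other than 4 exists if 3 does not divide the
  defect \<open>m - d\<close>, and if all of them have size 4, there are too few to absorb all meetings.\<close>

definition cond32 :: "nat \<Rightarrow> nat \<Rightarrow> nat \<Rightarrow> bool" where
  "cond32 m d c \<longleftrightarrow> m + c \<le> covered 32 d c + 9 \<and>
     (4 \<le> c * d div 32 \<or> c * (d + 1) div 32 = c * d div 32 \<and>
       ((m - d) mod 3 \<noteq> 0 \<or> 0 < m - d \<and> m - d < 3 * (c * d div 32)))"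

text \<open>The \<open>j\<close> positions in columns of size 1 all fall on new rows, so the defect
  is at most \<open>n - cover n cs - j\<close>.\<close>

definition settled :: "nat \<Rightarrow> nat list \<Rightarrow> nat \<Rightarrow> bool" where
  "settled n cs j \<longleftrightarrow> (if n \<le> cover n cs + j + tol n then True else if n \<noteq> 32 \<or> cs = [] then False
     else cond32 (sum_list (tl cs)) (cover 32 (tl cs)) (hd cs))"

text \<open>For these patterns, in this order, the cover misses the bound by one.\<close>

definition special :: "nat \<Rightarrow> nat list \<Rightarrow> bool" where
  "special n cs \<longleftrightarrow> n = 27 \<and> cs = [9, 9, 9] \<or> n = 30 \<and> cs = [6, 6, 6, 6, 6] \<or> n = 31 \<and> cs = [6, 6, 6, 6, 7]"

text \<open>\<open>i\<close> is the number of rotations left. Started with the length of the list,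
  it is back in its original order when \<open>special\<close> is consulted.\<close>

fun some_rotation :: "nat \<Rightarrow> nat \<Rightarrow> nat list \<Rightarrow> nat \<Rightarrow> bool" where
  "some_rotation n i cs j = (if settled n cs j then True else if i = 0 then special n cs
     else some_rotation n (i - 1) (rotate1 cs) j)"

declare some_rotation.simps [simp del]

text \<open>Parts of size at least 2 are chosen in descending order. \<open>cs\<close> holds the
  parts chosen so far, \<open>d\<close> their cover, \<open>k\<close> the positions not yet
  assigned, \<open>c\<close> the largest part still allowed, and \<open>m\<close> the number of rows
  to be reached. At a leaf, the \<open>k\<close> positions left lie in columns of size 1, and the
  sorted order is tried before its rotations.\<close>

function all_partitions :: "nat \<Rightarrow> nat \<Rightarrow> nat \<Rightarrow> nat \<Rightarrow> nat \<Rightarrow> nat list \<Rightarrow> bool" where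
  "all_partitions n m d k c cs = (if c \<le> 1 \<or> k \<le> 1
     then (if m \<le> d + k then True else some_rotation n (length cs) cs k)
     else (if c \<le> k then all_partitions n m (covered n d c) (k - c) c (c # cs) else True) \<and>
       all_partitions n m d k (c - 1) cs)"
  by pat_completeness auto
termination by (relation "measure (\<lambda>(n, m, d, k, c, cs). k + c)") auto

declare all_partitions.simps [simp del]

text \<open>\<open>ys\<close> lists the parts still to come. Either its head is \<open>c\<close> and
  the branch that pushes \<open>c\<close> applies, or all its parts are below
  \<open>c\<close>.\<close>

lemma all_partitions_sound:
  assumes "all_partitions n m d k c cs" "d = cover n cs" "n \<le> m + tol n"
    and "sorted_wrt (\<ge>) ys" "\<And>y. y \<in> set ys \<Longrightarrow> 2 \<le> y \<and> y \<le> c" "sum_list ys \<le> k"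
  shows "\<exists>i. some_rotation n i (rev ys @ cs) (k - sum_list ys)"
  using assms
proof (induction n m d k c cs arbitrary: ys rule: all_partitions.induct)
  case (1 n m d k c cs)
  show ?case
  proof (cases "c \<le> 1 \<or> k \<le> 1")
    case True
    have "ys = []"
    proof (cases ys)
      case (Cons y ys')
      with "1.prems"(5)[of y] "1.prems"(6) True show ?thesis by auto
    qed
    show ?thesis
    proof (cases "m \<le> d + k")
      case True
      then have "n \<le> cover n cs + k + tol n" using "1.prems"(2,3) by simp
      then have "some_rotation n 0 cs k" by (simp add: some_rotation.simps settled_def)
      then show ?thesis using \<open>ys = []\<close> by auto
    next
      case False
      then have "some_rotation n (length cs) cs k"
        using "1.prems"(1) True by (simp add: all_partitions.simps[of n m d k c cs])
      then show ?thesis using \<open>ys = []\<close> by auto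
    qed
  next
    case False
    then have next1: "all_partitions n m d k (c - 1) cs"
      and next2: "c \<le> k \<Longrightarrow> all_partitions n m (covered n d c) (k - c) c (c # cs)"
      using "1.prems"(1) by (simp_all add: all_partitions.simps[of n m d k c cs])
    show ?thesis
    proof (cases "ys \<noteq> [] \<and> hd ys = c")
      case True
      then obtain ys' where ys: "ys = c # ys'" by (cases ys) auto
      then have ck: "c \<le> k" using "1.prems"(6) by simp
      have "\<exists>i. some_rotation n i (rev ys' @ c # cs) (k - c - sum_list ys')"
        by (rule "1.IH"(1)[OF False ck next2[OF ck]])
          (use "1.prems" ys in \<open>auto simp: covered_def\<close>)
      then show ?thesis using ys by (simp add: diff_diff_left)
    next
      case False
      have "y \<le> c - 1" if y: "y \<in> set ys" for y
      proof -
        obtain y' ys' where ys: "ys = y' # ys'" using y by (cases ys) auto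
        then have "y \<le> y'" using y "1.prems"(4) by auto
        moreover have "y' < c" using "1.prems"(5)[of y'] False ys by auto
        ultimately show ?thesis by simp
      qed
      then show ?thesis
        using \<open>\<not> (c \<le> 1 \<or> k \<le> 1)\<close> "1.prems" by (intro "1.IH"(2)[OF _ next1]) auto
    qed
  qed
qed

section \<open>Numerical side conditions\<close>

definition good :: "nat \<Rightarrow> nat \<Rightarrow> nat \<Rightarrow> bool" where
  "good n t m \<longleftrightarrow> list_all (\<lambda>s. fits n (t - s) s) [m..<t + 1]"

lemma goodD: "good n t m \<Longrightarrow> m \<le> s \<Longrightarrow> s \<le> t \<Longrightarrow> fits n (t - s) s"
  by (auto simp: good_def list_all_iff)

lemma all_good: "\<forall>n\<in>set [2..<38]. good n ((n + 3) div 4 + 1) 2"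
  by code_simp

lemma packable_if_tol:
  assumes "2 \<le> n" "n < 38" "defect n h \<le> tol n"
  shows "packable n h"
proof (cases "defect n h \<le> (n + 3) div 4")
  case True
  have "n \<in> set [2..<38]" using assms(1,2) by (simp only: set_upt atLeastLessThan_iff)
  then have "good n ((n + 3) div 4 + 1) 2" by (rule all_good[THEN bspec])
  then show ?thesis using assms(1) True by (intro packable_if_small_defect[OF _ True] goodD) auto
next
  case False
  then have n: "n = 20 \<or> n = 24 \<or> n = 28" "defect n h = (n + 3) div 4 + 1"
    using assms(3) by (auto simp: tol_def split: if_splits)
  have "good 20 7 3" "good 24 8 3" "good 28 9 3" by code_simp+
  then have "good n (defect n h + 1) 3" using n by auto
  then show ?thesis using n by (intro packable_if_fits goodD) auto
qed

text \<open>These defects are \<open>tol n + 1\<close>.\<close>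

lemma packable_if_pair_and_triple':
  assumes "n = 27 \<and> defect n h = 8 \<or> (n = 30 \<or> n = 31) \<and> defect n h = 9"
    and "q \<in> Z n" "3 \<le> h q" "p \<in> Z n" "h p = 2"
  shows "packable n h"
proof -
  have "good 27 8 3" "good 30 9 3" "good 31 9 3" by code_simp+
  then have "good n (defect n h) 3" using assms(1) by auto
  with assms show ?thesis by (intro packable_if_pair_and_triple[of n h q p] goodD) auto
qed

lemma attains_packable_32:
  assumes K: "finite K" "k \<notin> K" "S k \<subseteq> Z 32" and h: "attains 32 S K h"
    and S: "\<And>x. x \<in> K \<Longrightarrow> S x \<subseteq> Z 32"
    and "d \<le> card (occ 32 h)" "sum h (Z 32) = m" "cond32 m d (card (S k))"
  shows "\<exists>h'. attains 32 S (insert k K) h' \<and> packable 32 h'"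
proof -
  let ?c = "card (S k)"
  let ?f = "?c * d div 32"
  have dm: "defect 32 h + card (occ 32 h) = m" using defect_occ[of 32 h] assms(7) by simp
  have small: "packable 32 h'" if "defect 32 h' \<le> 8" for h'
    using that by (intro packable_if_tol) (auto simp: tol_def)
  have c32: "?c \<le> 32" using card_mono[OF finite_Z K(3)] by simp
  have m9: "m + ?c \<le> covered 32 d ?c + 9" using assms(8) by (simp add: cond32_def)
  have fc: "?c * e div 32 \<le> e" for e
    using div_le_mono[OF mult_le_mono1[OF c32, of e], of 32] by simp
  show ?thesis
  proof (cases "4 \<le> ?f")
    case True
    obtain X where X: "X \<subseteq> Z 32" "card X = ?c" "attains 32 S (insert k K) (pile X h)"
      "(\<Sum>r\<in>X. of_bool (r \<in> occ 32 h)) \<le> ?c * (\<Sum>r\<in>Z 32. of_bool (r \<in> occ 32 h)) div 32"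
      using attains_light[of 32, OF _ K h, of "\<lambda>r. of_bool (r \<in> occ 32 h)"] by auto
    have o: "occ 32 h \<subseteq> Z 32" by (auto simp: occ_def)
    have N: "card (X \<inter> occ 32 h) \<le> ?c * card (occ 32 h) div 32"
      using X(4) unfolding sum_indicator[OF o X(1)] sum_indicator[OF o order_refl]
      using o by (simp add: Int_absorb1)
    have def: "defect 32 (pile X h) = defect 32 h + card (X \<inter> occ 32 h)" by (rule defect_pile[OF X(1)])
    have "covered 32 d ?c \<le> covered 32 (card (occ 32 h)) ?c" by (rule covered_mono[OF assms(6) c32]) simp
    then have le9: "defect 32 (pile X h) \<le> 9"
      using m9 N def dm fc[of "card (occ 32 h)"] fc[of d] unfolding covered_def by linarith
    have "packable 32 (pile X h)"
    proof (cases "defect 32 (pile X h) \<le> 8")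
      case False
      with le9 have nine: "defect 32 (pile X h) = 9" by simp
      \<comment> \<open>All rows met become heavy. If every heavy row had size 4, four of them would
        give defect at least 12.\<close>
      have "4 \<le> card (X \<inter> occ 32 h)"
        using nine def dm m9 fc[of d] True assms(6) unfolding covered_def by linarith
      moreover have "X \<inter> occ 32 h \<subseteq> heavy 32 (pile X h)" by (auto simp: occ_def heavy_def pile_def)
      ultimately have "4 \<le> card (heavy 32 (pile X h))" by (meson card_mono finite_heavy le_trans)
      then have "\<exists>q\<in>heavy 32 (pile X h). pile X h q \<noteq> 4"
        using card_heavy_le[of 32 "pile X h" 3] nine by force
      then show ?thesis using packable_32[OF nine] by blast
    qed (rule small)
    with X(3) show ?thesis by blast
  next
    case False
    then have f: "?c * (d + 1) div 32 = ?f"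
      and md: "(m - d) mod 3 \<noteq> 0 \<or> 0 < m - d \<and> m - d < 3 * ?f"
      using assms(8) by (auto simp: cond32_def)
    show ?thesis
    proof (cases "card (occ 32 h) = d")
      case True
      then have def: "defect 32 h = m - d" using dm by simp
      then have "heavy 32 h \<noteq> {}" using md by (auto simp: defect_as_heavy)
      then obtain q where q: "q \<in> heavy 32 h" "h q \<noteq> 4 \<or> (\<forall>x\<in>heavy 32 h. h x = 4)" by blast
      have le: "?c * (card (occ 32 h) + 1) div 32 \<le> ?f" using True f by simp
      have d9: "defect 32 h + ?f \<le> 9" using def m9 fc[of d] dm True unfolding covered_def by linarith
      from attains_missing_heavy[of 32, OF _ K h le q(1)] show ?thesis
      proof cases
        case (2 h')
        then show ?thesis using small[of h'] d9 by auto
      next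
        case (3 X)
        show ?thesis
        proof (cases "defect 32 (pile X h) \<le> 8")
          case False
          then have "defect 32 (pile X h) = 9" using 3(2) d9 by simp
          moreover have "\<exists>p\<in>heavy 32 (pile X h). pile X h p \<noteq> 4"
          proof (cases "h q = 4")
            case False
            then show ?thesis using q 3(4) by (auto simp: heavy_def pile_def intro!: bexI[of _ q])
          next
            case True
            \<comment> \<open>All heavy rows have size 4 and are fewer than the rows met, so a row
              of height 1 becomes a pair.\<close>
            then have "defect 32 h = (\<Sum>r\<in>heavy 32 h. 3)"
              using q(2) unfolding defect_as_heavy by (intro sum.cong) auto
            then have "m - d = 3 * card (heavy 32 h)" using def by simp
            then have "card (heavy 32 h) < card (X \<inter> occ 32 h)" using md 3(5) by simp
            then have "\<not> X \<inter> occ 32 h \<subseteq> heavy 32 h" using card_mono[OF finite_heavy] by (meson leD)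
            then obtain p where "p \<in> X" "p \<in> occ 32 h" "p \<notin> heavy 32 h" by blast
            then show ?thesis by (auto simp: occ_def heavy_def pile_def intro!: bexI[of _ p])
          qed
          ultimately show ?thesis using packable_32 3(1) by blast
        qed (use 3(1) small in blast)
      qed simp
    next
      case False
      \<comment> \<open>The quotient is the same for \<open>d + 1\<close>, so the additional
        occupied row lowers the final defect to at most 8.\<close>
      then have d1: "d + 1 \<le> card (occ 32 h)" using assms(6) by simp
      obtain h' where h': "attains 32 S (insert k K) h'" "covered 32 (d + 1) ?c \<le> card (occ 32 h')"
        using attains_covered[of 32, OF _ K h d1] by auto
      have "sum h' (Z 32) = (\<Sum>x\<in>insert k K. card (S x))"
        using h'(1) K S by (intro attains_sum) auto
      also have "\<dots> = m + ?c"
        using attains_sum[of 32, OF _ K(1) S h] assms(7) K by simp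
      finally have "sum h' (Z 32) = m + ?c" .
      then have "defect 32 h' \<le> 8"
        using defect_occ[of 32 h'] h'(2) m9 f fc[of d] unfolding covered_def by linarith
      then show ?thesis using small h'(1) by blast
    qed
  qed
qed

section \<open>From the search to a packing\<close>

definition search :: "nat \<Rightarrow> bool" where
  "search n \<longleftrightarrow> all_partitions n (n - tol n) 0 n n []"

context
  fixes n :: nat and S :: "int \<Rightarrow> int set"
  assumes n: "2 \<le> n" "n < 38" and S: "\<And>k. S k \<subseteq> Z n"
begin

lemma defect_attained:
  assumes "finite K" "attains n S K h"
  shows "defect n h + card (occ n h) = (\<Sum>k\<in>K. card (S k))"
  using attains_sum[OF _ assms(1) S assms(2)] defect_occ[of n h] n by simp

text \<open>With 15 rows occupied the defect is 3, and plain averaging allows 5 meetings, one too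
  many. Since \<open>9 * 14 div 27 = 4\<close>, either one is saved or a heavy row is hit; as 3 < 5,
  a pair then arises too.\<close>

lemma attains_packable_27:
  assumes "n = 27" "finite K" "k \<notin> K" "card (S k) = 9" "(\<Sum>k\<in>K. card (S k)) = 18"
    and "attains n S K h" "15 \<le> card (occ n h)"
  shows "\<exists>h'. attains n S (insert k K) h' \<and> packable n h'"
proof -
  have n0: "n > 0" using n by simp
  have sum: "(\<Sum>k\<in>insert k K. card (S k)) = 27" using assms by simp
  note def = defect_attained[OF assms(2,6)]
  show ?thesis
  proof (cases "card (occ n h) = 15")
    case False
    then have "16 \<le> card (occ n h)" using assms(7) by simp
    then obtain h' where h': "attains n S (insert k K) h'" "covered n 16 9 \<le> card (occ n h')"
      using attains_covered[OF n0 assms(2,3) S assms(6)] assms(4) by metis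
    then have "defect n h' \<le> tol n"
      using defect_attained[OF _ h'(1)] sum assms(1,2) by (simp add: covered_def tol_def)
    then show ?thesis using packable_if_tol[OF n] h'(1) by blast
  next
    case True
    then have "defect n h = 3" "card (S k) * (card (occ n h) - 1) div n < 5" "defect n h > 0"
      using def assms by auto
    note three = this
    from attains_hitting_heavy[OF n0 assms(2,3) S assms(6) three(2,3)] show ?thesis
    proof cases
      case (1 h')
      then have "defect n h' \<le> tol n" using three assms(1) by (simp add: tol_def)
      then show ?thesis using packable_if_tol[OF n] 1(1) by blast
    next
      case (2 h' q)
      then obtain p where "p \<in> Z n" "h' p = 2" using three by auto
      then have "packable n h'" using 2 three assms(1) by (intro packable_if_pair_and_triple'[of n h' q p]) auto
      then show ?thesis using 2(1) by blast
    qed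
  qed
qed

text \<open>In the worst case \<open>n - 15\<close> rows are occupied and the defect is 3. Column
  \<open>k\<close> saves a meeting or leaves defect 6 with a row of size at least 3; then
  \<open>k'\<close> yields defect at most 8, or 9 with a pair and such a row.\<close>

lemma attains_packable_30_31:
  assumes "n = 30 \<or> n = 31" "finite K" "k \<notin> K" "k' \<notin> insert k K" "card (S k) = 6" "card (S k') = 6"
    and "(\<Sum>k\<in>K. card (S k)) + 12 = n" "attains n S K h" "n \<le> card (occ n h) + 15"
  shows "\<exists>h'. attains n S (insert k' (insert k K)) h' \<and> packable n h'"
proof -
  have n0: "n > 0" using n by simp
  have fin: "finite (insert k K)" using assms(2) by simp
  have sum: "(\<Sum>k\<in>insert k K. card (S k)) + 6 = n" "(\<Sum>k\<in>insert k' (insert k K). card (S k)) = n"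
    using assms by simp_all
  \<comment> \<open>From \<open>n - 11\<close> occupied rows, plain averaging ends with defect at
    most 8.\<close>
  have last: ?thesis if h1: "attains n S (insert k K) h1" "n \<le> card (occ n h1) + 11" for h1
  proof -
    have "n - 11 \<le> card (occ n h1)" using h1(2) by simp
    then obtain h' where h': "attains n S (insert k' (insert k K)) h'" "covered n (n - 11) 6 \<le> card (occ n h')"
      using attains_covered[OF n0 fin assms(4) S h1(1)] assms(6) by metis
    then have "defect n h' \<le> tol n"
      using defect_attained[OF _ h'(1)] sum assms(1,2) by (auto simp: covered_def tol_def)
    then show ?thesis using packable_if_tol[OF n] h'(1) by blast
  qed
  note def = defect_attained[OF assms(2,8)]
  show ?thesis
  proof (cases "card (occ n h) + 15 = n")
    case False
    then have "n - 14 \<le> card (occ n h)" using assms(9) by simp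
    then obtain h' where h': "attains n S (insert k K) h'" "covered n (n - 14) 6 \<le> card (occ n h')"
      using attains_covered[OF n0 assms(2,3) S assms(8)] assms(5) by metis
    then show ?thesis using last[OF h'(1)] assms(1) by (auto simp: covered_def)
  next
    case True
    then have "defect n h = 3" "card (S k) * (card (occ n h) - 1) div n < 3" "defect n h > 0"
      using def assms by auto
    note three = this
    from attains_hitting_heavy[OF n0 assms(2,3) S assms(8) three(2,3)] show ?thesis
    proof cases
      case (1 h')
      then show ?thesis using last[OF 1(1)] defect_attained[OF fin 1(1)] sum(1) three by simp
    next
      case (2 h1 q)
      have occ1: "card (occ n h1) + 12 = n" "defect n h1 = 6"
        using defect_attained[OF fin 2(1)] 2(2) three sum(1) by auto
      then have "card (S k') * (card (occ n h1) + 1) div n \<le> 3" using assms(1,6) by auto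
      from attains_pair_and_triple[OF n0 fin assms(4) S 2(1) this occ1(2) 2(3,4)] show ?thesis
      proof cases
        case (1 h')
        then have "defect n h' \<le> tol n" using assms(1) by (auto simp: tol_def)
        then show ?thesis using packable_if_tol[OF n] 1(1) by blast
      next
        case 2: (2 h' p q)
        then have "packable n h'" using assms(1) by (intro packable_if_pair_and_triple'[of n h' q p]) auto
        then show ?thesis using 2(1) by blast
      qed
    qed
  qed
qed

lemma attains_packable_if_settled:
  assumes "settled n (map (\<lambda>k. card (S k)) ks) j" "distinct ks" "(\<Sum>k\<leftarrow>ks. card (S k)) + j = n"
  shows "\<exists>h. attains n S (set ks) h \<and> packable n h"
proof -
  have n0: "n > 0" using n by simp
  let ?c = "\<lambda>k. card (S k)"
  have sum: "(\<Sum>k\<in>set ks. ?c k) + j = n" using assms(2,3) by (simp add: sum_list_distinct_conv_sum_set)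
  show ?thesis
  proof (cases "n \<le> cover n (map ?c ks) + j + tol n")
    case True
    obtain h where h: "attains n S (set ks) h" "cover n (map ?c ks) \<le> card (occ n h)"
      using attains_cover[where S = S, OF n0 assms(2) S] by blast
    then have "defect n h \<le> tol n" using True sum defect_attained[OF finite_set h(1)] by linarith
    then show ?thesis using packable_if_tol[OF n] h(1) by blast
  next
    case False
    then have n32: "n = 32" and "ks \<noteq> []"
      and c: "cond32 (sum_list (tl (map ?c ks))) (cover 32 (tl (map ?c ks))) (hd (map ?c ks))"
      using assms(1) by (auto simp: settled_def split: if_splits)
    then obtain k ks' where ks: "ks = k # ks'" by (cases ks) auto
    then have d: "distinct ks'" "k \<notin> set ks'" using assms(2) by auto
    obtain h where h: "attains n S (set ks') h" "cover n (map ?c ks') \<le> card (occ n h)"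
      using attains_cover[where S = S, OF n0 d(1) S] by blast
    have "sum h (Z n) = sum_list (map ?c ks')"
      using attains_sum[OF n0 finite_set S h(1)] d(1) by (simp add: sum_list_distinct_conv_sum_set)
    then show ?thesis
      using attains_packable_32[of "set ks'" k S h "cover n (map ?c ks')" "sum_list (map ?c ks')"] h c d S n32 ks
      by auto
  qed
qed

lemma attains_packable_if_special:
  assumes "special n (map (\<lambda>k. card (S k)) ks)" "distinct ks"
  shows "\<exists>h. attains n S (set ks) h \<and> packable n h"
proof -
  have n0: "n > 0" using n by simp
  let ?c = "\<lambda>k. card (S k)"
  consider (1) "n = 27" "map ?c ks = [9, 9, 9]" | (2) "n = 30 \<or> n = 31" "map ?c ks = [6, 6, 6, 6, n - 24]"
    using assms(1) by (auto simp: special_def)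
  then show ?thesis
  proof cases
    case 1
    then obtain k k1 k2 where ks: "ks = [k, k1, k2]" "?c k = 9" "?c k1 = 9" "?c k2 = 9" by auto
    obtain h where h: "attains n S (set [k1, k2]) h" "cover n (map ?c [k1, k2]) \<le> card (occ n h)"
      using attains_cover[of n "[k1, k2]" S] n0 S assms(2) ks by auto
    have "15 \<le> card (occ n h)" using h(2) ks 1 by (simp add: covered_def)
    then show ?thesis
      using attains_packable_27[of "set [k1, k2]" k h] 1 ks h assms(2) by simp
  next
    case 2
    then obtain k k1 k2 k3 k4 where ks: "ks = [k, k1, k2, k3, k4]" "?c k = 6" "?c k1 = 6" "?c k2 = 6"
      "?c k3 = 6" "?c k4 = n - 24" by auto
    obtain h where h: "attains n S (set [k2, k3, k4]) h" "cover n (map ?c [k2, k3, k4]) \<le> card (occ n h)"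
      using attains_cover[of n "[k2, k3, k4]" S] n0 S assms(2) ks by auto
    have "n \<le> card (occ n h) + 15" using h(2) ks 2 by (auto simp: covered_def)
    then show ?thesis
      using attains_packable_30_31[of "set [k2, k3, k4]" k1 k h] 2 ks h assms(2) by auto
  qed
qed

text \<open>Rotating the size list means placing the same columns in another order.\<close>

lemma attains_packable_if_some_rotation:
  assumes "some_rotation n i (map (\<lambda>k. card (S k)) ks) j" "distinct ks" "(\<Sum>k\<leftarrow>ks. card (S k)) + j = n"
  shows "\<exists>h. attains n S (set ks) h \<and> packable n h"
  using assms
proof (induction i arbitrary: ks)
  case 0
  then show ?case
    using attains_packable_if_settled[of ks j] attains_packable_if_special[of ks]
    by (auto simp: some_rotation.simps[of n 0] split: if_splits)
next
  case (Suc i)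
  show ?case
  proof (cases "settled n (map (\<lambda>k. card (S k)) ks) j")
    case True
    then show ?thesis using attains_packable_if_settled Suc.prems by blast
  next
    case False
    then have "some_rotation n i (map (\<lambda>k. card (S k)) (rotate1 ks)) j"
      using Suc.prems(1) by (simp add: some_rotation.simps[of n "Suc i"] rotate1_map)
    moreover have "(\<Sum>k\<leftarrow>rotate1 ks. card (S k)) = (\<Sum>k\<leftarrow>ks. card (S k))"
      by (cases ks) auto
    ultimately show ?thesis using Suc.IH[of "rotate1 ks"] Suc.prems by simp
  qed
qed

lemma attains_packable:
  assumes "search n" "(\<Sum>k\<in>Z n. card (S k)) = n"
  shows "\<exists>h. attains n S {k \<in> Z n. 2 \<le> card (S k)} h \<and> packable n h"
proof -
  let ?c = "\<lambda>k. card (S k)" and ?K = "{k \<in> Z n. 2 \<le> card (S k)}"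
  \<comment> \<open>Sorted by size, the columns give one of the lists that
    \<open>all_partitions\<close> enumerates.\<close>
  define ks where "ks = sort_key ?c (sorted_list_of_set ?K)"
  have ks: "set ks = ?K" "distinct ks" by (simp_all add: ks_def)
  have sum: "sum_list (map ?c ks) = (\<Sum>k\<in>?K. ?c k)"
    using ks by (simp add: sum_list_distinct_conv_sum_set)
  also have "\<dots> \<le> n" using assms(2) sum_mono2[of "Z n" ?K ?c] by simp
  finally have le: "sum_list (map ?c ks) \<le> n" .
  have "sorted (map ?c ks)" by (simp add: ks_def)
  then have "sorted_wrt (\<ge>) (rev (map ?c ks))" unfolding sorted_wrt_rev by simp
  moreover have "2 \<le> y \<and> y \<le> n" if "y \<in> set (rev (map ?c ks))" for y
    using that ks(1) card_mono[OF finite_Z S] by auto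
  ultimately have "\<exists>i. some_rotation n i (rev (rev (map ?c ks)) @ []) (n - sum_list (rev (map ?c ks)))"
    using assms(1) le by (intro all_partitions_sound[of n "n - tol n" 0 n n "[]"]) (simp_all add: search_def)
  then obtain i where "some_rotation n i (map ?c ks) (n - sum_list (map ?c ks))" by auto
  from attains_packable_if_some_rotation[OF this ks(2)] show ?thesis using ks le by simp
qed

lemma attains_packs:
  assumes "search n" "(\<Sum>k\<in>Z n. card (S k)) = n"
  shows "\<exists>h. attains n S (Z n) h \<and> packs n h"
proof -
  let ?K = "{k \<in> Z n. 2 \<le> card (S k)}" and ?J = "{k \<in> Z n. card (S k) \<le> 1}"
  obtain h where h: "attains n S ?K h" "packable n h" using attains_packable[OF assms] by blast
  have KJ: "?K \<union> ?J = Z n" "?J \<inter> ?K = {}" by auto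
  have "\<exists>X. X \<subseteq> Z n - occ n h \<and> attains n S (?K \<union> ?J) (pile X h)"
  proof (rule attains_singles[OF _ _ h(1) _ KJ(2) S])
    show "(\<Sum>k\<in>?K \<union> ?J. card (S k)) \<le> n" unfolding KJ(1) assms(2) ..
  qed (use n in auto)
  then obtain X where X: "X \<subseteq> Z n - occ n h" "attains n S (Z n) (pile X h)"
    unfolding KJ(1) by blast
  have "sum (pile X h) (Z n) = n"
    using attains_sum[OF _ finite_Z S X(2)] n assms(2) by simp
  with h(2) X(1) have "packs n (pile X h)" unfolding packable_def by simp
  with X(2) show ?thesis by blast
qed

end

lemma shuffle_exists:
  assumes "2 \<le> n" "n < 38" "search n" "P \<subseteq> square n" "card P = n"
  shows "\<exists>\<sigma>. VH_shuffle n \<sigma> \<and> H_graph n (\<sigma> ` P)"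
proof -
  define S where "S = (\<lambda>k. {r. (k, r) \<in> P})"
  have S: "S k \<subseteq> Z n" for k using assms(4) by (auto simp: S_def square_def Z_def)
  have fin: "finite (S k)" for k using finite_subset[OF S] by simp
  have "P = Sigma (Z n) S" using assms(4) by (auto simp: S_def square_def Z_def)
  then have "(\<Sum>k\<in>Z n. card (S k)) = n" using assms(5) fin by simp
  then obtain h where "attains n S (Z n) h" "packs n h"
    using attains_packs[where S = S, OF assms(1,2) S assms(3)] by blast
  then show ?thesis using shuffle_if_packs[OF _ assms(4,5) S_def] assms(1) by simp
qed

section \<open>Evaluation of the search\<close>

lemma search_small: "\<forall>n\<in>set [2..<26]. search n"
  by code_simp

lemma search_26: "search 26"
  by code_simp

lemma search_27: "search 27"
  by code_simp

lemma search_28: "search 28"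
  by code_simp

lemma search_29: "search 29"
  by code_simp

lemma search_30: "search 30"
  by code_simp

lemma search_31: "search 31"
  by code_simp

lemma search_32: "search 32"
  by code_simp

lemma search_33: "search 33"
  by code_simp

lemma search_34: "search 34"
  by code_simp

lemma search_37: "search 37"
  by code_simp

theorem mainTheorem1:
  fixes n :: nat
  assumes "2 \<le> n \<and> n \<le> 34 \<or> n = 37"
  shows "\<forall>S. S \<subseteq> square n \<and> card S = n \<longrightarrow> (\<exists>\<sigma>. VH_shuffle n \<sigma> \<and> H_graph n (\<sigma> ` S))"
proof -
  have "search n"
  proof (cases "n < 26")
    case True
    then have "n \<in> set [2..<26]" unfolding set_upt atLeastLessThan_iff using assms by linarith
    then show ?thesis by (rule search_small[THEN bspec])
  next
    case False
    then have "n = 26 \<or> n = 27 \<or> n = 28 \<or> n = 29 \<or> n = 30 \<or> n = 31 \<or> n = 32 \<or> n = 33 \<or> n = 34 \<or> n = 37"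
      using assms by presburger
    then show ?thesis
      using search_26 search_27 search_28 search_29 search_30 search_31 search_32 search_33 search_34 search_37
      by (elim disjE) simp_all
  qed
  then show ?thesis using shuffle_exists[of n] assms by auto
qed

end
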